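(* Let $\mathcal{H}$ be a complex Hilbert space of finite or countably infinite dimension, and let $\mathsf{A}=\{\mathsf{A}_1,\mathsf{A}_2\}$ and $\mathsf{B}=\{\mathsf{B}_1,\mathsf{B}_2\}$ be two-outcome observables on $\mathcal{H}$ which are sharp (all $\mathsf{A}_i,\mathsf{B}_j$ are projections) and do not commute. For $\mu,\nu\in(\tfrac12,1]$ define the two-outcome observables $$\mathsf{A}^{\mu}_1=\mu\mathsf{A}_1+(1-\mu)\mathsf{A}_2,\quad \mathsf{A}^{\mu}_2=(1-\mu)\mathsf{A}_1+\mu\mathsf{A}_2,$$ $$\mathsf{B}^{\nu}_1=\nu\mathsf{B}_1+(1-\nu)\mathsf{B}_2,\quad \mathsf{B}^{\nu}_2=(1-\nu)\mathsf{B}_1+\nu\mathsf{B}_2 .$$ Then: (1) if $\tfrac12<\mu\le\tfrac23$, the observables $\mathsf{A}^{\mu}$ and $\mathsf{B}^{\mu}$ are jointly measurable; (2) for all $\mu,\nu\in(\tfrac12,1]$, $\mathsf{A}^{\mu}$ cannot be measured without disturbing $\mathsf{B}^{\nu}$, and $\mathsf{B}^{\nu}$ cannot be measured without disturbing $\mathsf{A}^{\mu}$.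
   Context: An observable on $\mathcal{H}$ is a finite or countably infinite family $\mathsf{A}=\{\mathsf{A}_x\}_{x\in\Omega_{\mathsf{A}}}$ of positive bounded operators on $\mathcal{H}$ with $\sum_x\mathsf{A}_x=\mathbb{1}$ (a discrete POVM). Observables $\mathsf{A},\mathsf{B}$ commute if $\mathsf{A}_x\mathsf{B}_y=\mathsf{B}_y\mathsf{A}_x$ for all $x\in\Omega_{\mathsf{A}},y\in\Omega_{\mathsf{B}}$. They are jointly measurable if there is an observable $\mathsf{G}=\{\mathsf{G}_{x,y}\}$ with outcome set $\Omega_{\mathsf{A}}\times\Omega_{\mathsf{B}}$ such that $\sum_y\mathsf{G}_{x,y}=\mathsf{A}_x$ for all $x$ and $\sum_x\mathsf{G}_{x,y}=\mathsf{B}_y$ for all $y$. An instrument implementing $\mathsf{A}$ is a family $\mathcal{I}=\{\mathcal{I}_x\}_{x\in\Omega_{\mathsf{A}}}$ of completely positive linear maps on the trace class operators on $\mathcal{H}$ such that $\mathcal{I}_x^*(\mathbb{1})=\mathsf{A}_x$ for all $x$; here the adjoint $\mathcal{I}_x^*$, acting on bounded operators, is defined by $\mathrm{tr}[X\,\mathcal{I}_x(Y)]=\mathrm{tr}[\mathcal{I}_x^*(X)Y]$ for all bounded $X$ and trace class $Y$. Put $\mathcal{I}_\Omega:=\sum_x\mathcal{I}_x$, with adjoint $\mathcal{I}_\Omega^*$. $\mathsf{A}$ can be measured without disturbing $\mathsf{B}$ if there is an instrument $\mathcal{I}$ implementing $\mathsf{A}$ with $\mathcal{I}_\Omega^*(\mathsf{B}_y)=\mathsf{B}_y$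 for all $y\in\Omega_{\mathsf{B}}$. *)

theory Defs
  imports "HOL-Analysis.Analysis"
begin

section \<open>Complex Hilbert spaces\<close>

text \<open>The complex structure is put on top of the real Hilbert space structure of the library:
  the real inner product is the real part of the complex one, so that \<^term>\<open>norm\<close>, convergence and
  \<^term>\<open>(has_sum)\<close> are the library ones. Positive definiteness is inherited from
  \<^class>\<open>real_inner\<close>. The complex inner product is conjugate linear in its first argument.\<close>

class chilbert_space = real_inner + banach +
  fixes scaleC :: "complex \<Rightarrow> 'a \<Rightarrow> 'a" (infixr \<open>*\<^sub>C\<close> 75)
    and cinner :: "'a \<Rightarrow> 'a \<Rightarrow> complex"
  assumes scaleC_add_right: "c *\<^sub>C (x + y) = c *\<^sub>C x + c *\<^sub>C y"
    and scaleC_add_left: "(c + d) *\<^sub>C x = c *\<^sub>C x + d *\<^sub>C x"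
    and scaleC_scaleC: "c *\<^sub>C (d *\<^sub>C x) = (c * d) *\<^sub>C x"
    and scaleC_one: "1 *\<^sub>C x = x"
    and scaleR_scaleC: "r *\<^sub>R x = complex_of_real r *\<^sub>C x"
    and cinner_commute: "cinner x y = cnj (cinner y x)"
    and cinner_add_right: "cinner x (y + z) = cinner x y + cinner x z"
    and cinner_scaleC_right: "cinner x (c *\<^sub>C y) = c * cinner x y"
    and inner_Re_cinner: "inner x y = Re (cinner x y)"

text \<open>In the last conjunct \<^term>\<open>span\<close> is the real span, but of a set closed under complex
  scalar multiplication, hence it is the complex span of \<open>E\<close>.\<close>

definition is_onb :: "'a::chilbert_space set \<Rightarrow> bool" where
  "is_onb E \<longleftrightarrow> (\<forall>x\<in>E. cinner x x = 1) \<and> (\<forall>x\<in>E. \<forall>y\<in>E. x \<noteq> y \<longrightarrow> cinner x y = 0) \<and>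
     closure (span {c *\<^sub>C e | c e. e \<in> E}) = UNIV"

definition countable_dimension :: "'a::chilbert_space itself \<Rightarrow> bool" where
  "countable_dimension _ \<longleftrightarrow> (\<exists>E::'a set. countable E \<and> is_onb E)"


section \<open>Operators\<close>

definition bounded_clinear :: "('a::chilbert_space \<Rightarrow> 'a) \<Rightarrow> bool" where
  "bounded_clinear T \<longleftrightarrow> bounded_linear T \<and> (\<forall>c x. T (c *\<^sub>C x) = c *\<^sub>C T x)"

definition positive_op :: "('a::chilbert_space \<Rightarrow> 'a) \<Rightarrow> bool" where
  "positive_op T \<longleftrightarrow> bounded_clinear T \<and> (\<forall>\<psi>. cinner \<psi> (T \<psi>) \<in> \<real>\<^sub>\<ge>\<^sub>0)"

definition projection_op :: "('a::chilbert_space \<Rightarrow> 'a) \<Rightarrow> bool" where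
  "projection_op P \<longleftrightarrow> bounded_clinear P \<and> P \<circ> P = P \<and> (\<forall>x y. cinner (P x) y = cinner x (P y))"

text \<open>\<open>is_abs_op T P\<close> says that \<open>P\<close> is the absolute value of \<open>T\<close>, i.e. the (unique) positive square
  root of the product of the adjoint of \<open>T\<close> with \<open>T\<close>; the adjoint is moved to the left argument
  of the inner product.\<close>

definition is_abs_op :: "('a::chilbert_space \<Rightarrow> 'a) \<Rightarrow> ('a \<Rightarrow> 'a) \<Rightarrow> bool" where
  "is_abs_op T P \<longleftrightarrow> positive_op P \<and> (\<forall>x y. cinner x (P (P y)) = cinner (T x) (T y))"

definition trace_class :: "('a::chilbert_space \<Rightarrow> 'a) \<Rightarrow> bool" where
  "trace_class T \<longleftrightarrow> bounded_clinear T \<and>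
     (\<exists>P E. is_abs_op T P \<and> is_onb E \<and> (\<lambda>e. cinner e (P e)) summable_on E)"

text \<open>For trace class operators the value does not depend on the chosen orthonormal basis.\<close>

definition trace :: "('a::chilbert_space \<Rightarrow> 'a) \<Rightarrow> complex" where
  "trace T = (\<Sum>\<^sub>\<infinity>e\<in>(SOME E. is_onb E). cinner e (T e))"


section \<open>Observables\<close>

text \<open>Operator sums are taken in the strong operator topology, i.e. pointwise on vectors.\<close>

definition observable :: "'x set \<Rightarrow> ('x \<Rightarrow> 'a::chilbert_space \<Rightarrow> 'a) \<Rightarrow> bool" where
  "observable \<Omega> A \<longleftrightarrow> countable \<Omega> \<and> (\<forall>x\<in>\<Omega>. positive_op (A x)) \<and>
     (\<forall>\<psi>. ((\<lambda>x. A x \<psi>) has_sum \<psi>) \<Omega>)"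

definition sharp :: "'x set \<Rightarrow> ('x \<Rightarrow> 'a::chilbert_space \<Rightarrow> 'a) \<Rightarrow> bool" where
  "sharp \<Omega> A \<longleftrightarrow> (\<forall>x\<in>\<Omega>. projection_op (A x))"

definition commuting ::
  "'x set \<Rightarrow> ('x \<Rightarrow> 'a::chilbert_space \<Rightarrow> 'a) \<Rightarrow> 'y set \<Rightarrow> ('y \<Rightarrow> 'a \<Rightarrow> 'a) \<Rightarrow> bool" where
  "commuting \<Omega>A A \<Omega>B B \<longleftrightarrow> (\<forall>x\<in>\<Omega>A. \<forall>y\<in>\<Omega>B. A x \<circ> B y = B y \<circ> A x)"

definition jointly_measurable ::
  "'x set \<Rightarrow> ('x \<Rightarrow> 'a::chilbert_space \<Rightarrow> 'a) \<Rightarrow> 'y set \<Rightarrow> ('y \<Rightarrow> 'a \<Rightarrow> 'a) \<Rightarrow> bool" where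
  "jointly_measurable \<Omega>A A \<Omega>B B \<longleftrightarrow> (\<exists>G. observable (\<Omega>A \<times> \<Omega>B) G \<and>
     (\<forall>x\<in>\<Omega>A. \<forall>\<psi>. ((\<lambda>y. G (x, y) \<psi>) has_sum A x \<psi>) \<Omega>B) \<and>
     (\<forall>y\<in>\<Omega>B. \<forall>\<psi>. ((\<lambda>x. G (x, y) \<psi>) has_sum B y \<psi>) \<Omega>A))"


section \<open>Instruments\<close>

text \<open>Maps on trace class operators are total functions on all operators; only their values on
  trace class operators matter.\<close>

definition trace_class_linear ::
  "(('a::chilbert_space \<Rightarrow> 'a) \<Rightarrow> ('a \<Rightarrow> 'a)) \<Rightarrow> bool" where
  "trace_class_linear \<Phi> \<longleftrightarrow>
     (\<forall>Y. trace_class Y \<longrightarrow> trace_class (\<Phi> Y)) \<and>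
     (\<forall>Y Z. trace_class Y \<longrightarrow> trace_class Z \<longrightarrow>
        \<Phi> (\<lambda>\<psi>. Y \<psi> + Z \<psi>) = (\<lambda>\<psi>. \<Phi> Y \<psi> + \<Phi> Z \<psi>)) \<and>
     (\<forall>c Y. trace_class Y \<longrightarrow> \<Phi> (\<lambda>\<psi>. c *\<^sub>C Y \<psi>) = (\<lambda>\<psi>. c *\<^sub>C \<Phi> Y \<psi>))"

text \<open>Operators on the tensor product of the Hilbert space with an \<open>n\<close>-dimensional one are
  \<open>n \<times> n\<close> block matrices \<open>Y\<close> of operators, acting on \<open>n\<close>-tuples of vectors.\<close>

definition block_positive :: "nat \<Rightarrow> (nat \<Rightarrow> nat \<Rightarrow> 'a::chilbert_space \<Rightarrow> 'a) \<Rightarrow> bool" where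
  "block_positive n Y \<longleftrightarrow>
     (\<forall>\<psi>::nat \<Rightarrow> 'a. (\<Sum>i<n. \<Sum>j<n. cinner (\<psi> i) (Y i j (\<psi> j))) \<in> \<real>\<^sub>\<ge>\<^sub>0)"

definition completely_positive ::
  "(('a::chilbert_space \<Rightarrow> 'a) \<Rightarrow> ('a \<Rightarrow> 'a)) \<Rightarrow> bool" where
  "completely_positive \<Phi> \<longleftrightarrow> (\<forall>n Y. (\<forall>i<n. \<forall>j<n. trace_class (Y i j)) \<longrightarrow> block_positive n Y \<longrightarrow>
     block_positive n (\<lambda>i j. \<Phi> (Y i j)))"

text \<open>\<open>adjoint_maps \<Phi> X Z\<close> says that the adjoint of \<open>\<Phi>\<close> sends the bounded operator \<open>X\<close> to the
  bounded operator \<open>Z\<close>. The trace equations determine \<open>Z\<close>, as rank one operators \<open>Y\<close> show.\<close>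

definition adjoint_maps ::
  "(('a::chilbert_space \<Rightarrow> 'a) \<Rightarrow> ('a \<Rightarrow> 'a)) \<Rightarrow> ('a \<Rightarrow> 'a) \<Rightarrow> ('a \<Rightarrow> 'a) \<Rightarrow> bool" where
  "adjoint_maps \<Phi> X Z \<longleftrightarrow> bounded_clinear X \<and> bounded_clinear Z \<and>
     (\<forall>Y. trace_class Y \<longrightarrow> trace (X \<circ> \<Phi> Y) = trace (Z \<circ> Y))"

definition implementing_instrument ::
  "'x set \<Rightarrow> ('x \<Rightarrow> 'a::chilbert_space \<Rightarrow> 'a) \<Rightarrow> ('x \<Rightarrow> ('a \<Rightarrow> 'a) \<Rightarrow> ('a \<Rightarrow> 'a)) \<Rightarrow> bool" where
  "implementing_instrument \<Omega> A I \<longleftrightarrow>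
     (\<forall>x\<in>\<Omega>. trace_class_linear (I x) \<and> completely_positive (I x) \<and> adjoint_maps (I x) id (A x))"

text \<open>For an infinite outcome set the operators \<open>I x Y\<close> are summable in trace norm, hence also
  pointwise on vectors and with the same sum.\<close>

definition total_map ::
  "'x set \<Rightarrow> ('x \<Rightarrow> ('a::chilbert_space \<Rightarrow> 'a) \<Rightarrow> ('a \<Rightarrow> 'a)) \<Rightarrow> ('a \<Rightarrow> 'a) \<Rightarrow> ('a \<Rightarrow> 'a)" where
  "total_map \<Omega> I Y = (\<lambda>\<psi>. \<Sum>\<^sub>\<infinity>x\<in>\<Omega>. I x Y \<psi>)"

definition measurable_without_disturbing ::
  "'x set \<Rightarrow> ('x \<Rightarrow> 'a::chilbert_space \<Rightarrow> 'a) \<Rightarrow> 'y set \<Rightarrow> ('y \<Rightarrow> 'a \<Rightarrow> 'a) \<Rightarrow> bool" where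
  "measurable_without_disturbing \<Omega>A A \<Omega>B B \<longleftrightarrow> (\<exists>I. implementing_instrument \<Omega>A A I \<and>
     (\<forall>y\<in>\<Omega>B. adjoint_maps (total_map \<Omega>A I) (B y) (B y)))"


section \<open>Unsharp versions of two-outcome observables\<close>

definition unsharp :: "real \<Rightarrow> (nat \<Rightarrow> 'a::chilbert_space \<Rightarrow> 'a) \<Rightarrow> nat \<Rightarrow> 'a \<Rightarrow> 'a" where
  "unsharp \<mu> A i = (if i = 1 then (\<lambda>\<psi>. \<mu> *\<^sub>R A 1 \<psi> + (1 - \<mu>) *\<^sub>R A 2 \<psi>)
     else (\<lambda>\<psi>. (1 - \<mu>) *\<^sub>R A 1 \<psi> + \<mu> *\<^sub>R A 2 \<psi>))"

end

theory Submission
  imports Defs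
begin

text \<open>Let \<open>I\<close> implement \<open>A\<^sup>\<mu>\<close> without disturbing \<open>B\<^sup>\<nu>\<close>. As \<open>\<nu> \<noteq> 1/2\<close>, the dual of the total
  operation fixes the projections \<open>B\<^sub>1\<close> and \<open>B\<^sub>2\<close>, so the dual of \<open>I\<^sub>1\<close> maps \<open>B\<^sub>j\<close> to a positive
  operator below \<open>B\<^sub>j\<close>. Such an operator commutes with \<open>B\<^sub>j\<close>, and the two images add up to the effect
  \<open>A\<^sup>\<mu>\<^sub>1\<close>; hence \<open>A\<^sup>\<mu>\<^sub>1\<close> commutes with \<open>B\<^sub>j\<close>, and so does \<open>A\<^sub>1\<close>. Only the trace class side of the
  duality is used: the image of \<open>B\<^sub>j\<close> is replaced by the quadratic form
  \<open>\<psi> \<mapsto> tr (B\<^sub>j I\<^sub>1(|\<psi>\<rangle>\<langle>\<psi>|))\<close>. That this trace is additive and nonnegative rests on the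
  Hilbert-Schmidt norm of the square root of a positive trace class operator.\<close>

declare One_nat_def [simp del]

section \<open>The complex inner product\<close>

lemma cinner_add_left: "cinner (x + y) z = cinner x z + cinner (y::'a::chilbert_space) z"
  by (metis cinner_add_right cinner_commute complex_cnj_add)

lemma cinner_scaleC_left: "cinner (c *\<^sub>C x) y = cnj c * cinner (x::'a::chilbert_space) y"
  by (metis cinner_commute cinner_scaleC_right complex_cnj_mult)

lemma cinner_self: "cinner x x = complex_of_real ((norm (x::'a::chilbert_space))\<^sup>2)"
proof (rule complex_eqI)
  show "Re (cinner x x) = Re (complex_of_real ((norm x)\<^sup>2))"
    by (simp add: inner_Re_cinner[symmetric] power2_norm_eq_inner)
  have "Im (cinner x x) = - Im (cinner x x)"
    by (metis cinner_commute cnj.sel(2))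
  thus "Im (cinner x x) = Im (complex_of_real ((norm x)\<^sup>2))" by simp
qed

text \<open>The norm is tied to complex scalars through \<open>cinner x x\<close>, which equals the
  squared norm and turns \<open>c\<close> into \<open>c * cnj c\<close>.\<close>

lemma norm_scaleC: "norm (c *\<^sub>C (x::'a::chilbert_space)) = norm c * norm x"
proof -
  have "complex_of_real ((norm (c *\<^sub>C x))\<^sup>2) = (c * cnj c) * complex_of_real ((norm x)\<^sup>2)"
    unfolding cinner_self[symmetric] by (simp add: cinner_scaleC_left cinner_scaleC_right)
  also have "\<dots> = complex_of_real ((norm c * norm x)\<^sup>2)"
    unfolding complex_norm_square[symmetric] by (simp add: power_mult_distrib)
  finally have "(norm (c *\<^sub>C x))\<^sup>2 = (norm c * norm x)\<^sup>2"
    unfolding of_real_eq_iff .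
  thus ?thesis by (rule power2_eq_imp_eq) simp_all
qed

text \<open>Recovers the full complex inner product from the real one, so that identities proved for
  \<open>inner\<close> lift to \<open>cinner\<close>.\<close>

lemma Im_cinner: "Im (cinner x y) = - inner (x::'a::chilbert_space) (\<i> *\<^sub>C y)"
  by (simp add: inner_Re_cinner cinner_scaleC_right)

lemma norm_cinner_le: "norm (cinner x y) \<le> norm x * norm (y::'a::chilbert_space)"
proof (cases "cinner x y = 0")
  case False
  \<comment> \<open>The phase that rotates \<open>cinner x y\<close> onto its modulus, which reduces
    the claim to the real Cauchy-Schwarz inequality.\<close>
  define c where "c = cnj (cinner x y) / complex_of_real (norm (cinner x y))"
  have c: "norm c = 1" using False by (simp add: c_def norm_divide)
  have "cnj (cinner x y) * cinner x y = complex_of_real ((norm (cinner x y))\<^sup>2)"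
    by (simp only: complex_norm_square mult.commute)
  hence "c * cinner x y = complex_of_real (norm (cinner x y))"
    using False by (simp add: c_def power2_eq_square)
  hence "inner x (c *\<^sub>C y) = norm (cinner x y)"
    by (simp add: inner_Re_cinner cinner_scaleC_right)
  moreover have "inner x (c *\<^sub>C y) \<le> norm x * norm y"
    using norm_cauchy_schwarz[of x "c *\<^sub>C y"] c by (simp add: norm_scaleC)
  ultimately show ?thesis by simp
qed simp

lemma bounded_bilinear_cinner: "bounded_bilinear (cinner :: 'a::chilbert_space \<Rightarrow> 'a \<Rightarrow> complex)"
proof
  show "\<exists>K. \<forall>a b. norm (cinner a (b::'a)) \<le> norm a * norm b * K"
    using norm_cinner_le by (metis mult.right_neutral)
qed (simp_all add: cinner_add_left cinner_add_right scaleR_scaleC cinner_scaleC_left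
      cinner_scaleC_right scaleR_conv_of_real)

interpretation cinner: bounded_bilinear "cinner :: 'a::chilbert_space \<Rightarrow> 'a \<Rightarrow> complex"
  by (rule bounded_bilinear_cinner)

lemma scaleC_scaleR: "c *\<^sub>C (r *\<^sub>R x) = r *\<^sub>R (c *\<^sub>C (x::'a::chilbert_space))"
  by (simp add: scaleR_scaleC scaleC_scaleC mult.commute)

lemma bounded_bilinear_scaleC: "bounded_bilinear ((*\<^sub>C) :: complex \<Rightarrow> 'a::chilbert_space \<Rightarrow> 'a)"
proof
  show "\<exists>K. \<forall>a b. norm (a *\<^sub>C (b::'a)) \<le> norm a * norm b * K"
    by (rule exI[of _ 1]) (simp add: norm_scaleC)
qed (simp_all add: scaleC_add_left scaleC_add_right scaleC_scaleR scaleR_scaleC[of _ x for x]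
      scaleR_conv_of_real scaleC_scaleC mult.commute)

interpretation scaleC: bounded_bilinear "(*\<^sub>C) :: complex \<Rightarrow> 'a::chilbert_space \<Rightarrow> 'a"
  by (rule bounded_bilinear_scaleC)

text \<open>Lifts real adjointness to the complex inner product: the imaginary part is the real
  inner product with a vector rotated by \<open>\<i>\<close>, and \<open>Q\<close> respects that
  rotation.\<close>

lemma cinner_symmetric:
  fixes R Q :: "'a::chilbert_space \<Rightarrow> 'a"
  assumes "\<And>x y. inner (R x) y = inner x (Q y)" and "\<And>x. Q (\<i> *\<^sub>C x) = \<i> *\<^sub>C Q x"
  shows "cinner (R x) y = cinner x (Q y)"
  by (rule complex_eqI) (use assms in \<open>simp_all add: Im_cinner flip: inner_Re_cinner\<close>)


section \<open>Orthonormal bases\<close>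

lemma onb_cinner: "is_onb E \<Longrightarrow> e \<in> E \<Longrightarrow> f \<in> E \<Longrightarrow> cinner e f = (if e = f then 1 else 0)"
  by (simp add: is_onb_def)

text \<open>The partial sum \<open>p\<close> and \<open>x\<close> have the same coefficients on
  \<open>F\<close>, so \<open>inner p p = inner p x\<close>, and Cauchy-Schwarz gives the
  bound.\<close>

lemma onb_partial_sum_bessel:
  fixes E :: "'a::chilbert_space set"
  assumes E: "is_onb E" and F: "finite F" "F \<subseteq> E"
  shows "norm (\<Sum>e\<in>F. cinner e x *\<^sub>C e) \<le> norm x"
proof -
  define p where "p = (\<Sum>e\<in>F. cinner e x *\<^sub>C e)"
  have ep: "cinner e p = cinner e x" if "e \<in> F" for e
  proof -
    have "cinner e p = (\<Sum>f\<in>F. cinner f x * cinner e f)"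
      by (simp add: p_def cinner.sum_right cinner_scaleC_right)
    also have "\<dots> = (\<Sum>f\<in>F. if f = e then cinner e x else 0)"
      using F that by (intro sum.cong refl) (auto simp: onb_cinner[OF E] subset_iff)
    finally show ?thesis using that F by simp
  qed
  have "cinner p p = (\<Sum>e\<in>F. cnj (cinner e x) * cinner e p)"
    by (subst (1) p_def) (simp add: cinner.sum_left cinner_scaleC_left)
  also have "\<dots> = (\<Sum>e\<in>F. cnj (cinner e x) * cinner e x)"
    using ep by simp
  also have "\<dots> = cinner p x"
    by (simp add: p_def cinner.sum_left cinner_scaleC_left)
  finally have "inner p p = inner p x" by (simp add: inner_Re_cinner)
  hence "norm p * norm p \<le> norm p * norm x"
    using norm_cauchy_schwarz[of p x] by (simp add: power2_eq_square flip: power2_norm_eq_inner)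
  hence "norm p \<le> norm x"
    by (cases "p = 0") simp_all
  thus ?thesis by (simp add: p_def)
qed

text \<open>The partial sums are contractions by Bessel and eventually reproduce each vector of the
  dense span; an approximation argument extends convergence to all of the space.\<close>

lemma onb_has_sum:
  fixes E :: "'a::chilbert_space set"
  assumes E: "is_onb E"
  shows "((\<lambda>e. cinner e x *\<^sub>C e) has_sum x) E"
proof -
  define p where "p F x = (\<Sum>e\<in>F. cinner e x *\<^sub>C e)" for F and x :: 'a
  have p_diff: "p F (x - y) = p F x - p F y" for F x y
    by (simp add: p_def cinner.diff_right scaleC.diff_left sum_subtractf)
  have ev: "\<exists>F. finite F \<and> F \<subseteq> E \<and> (\<forall>G. finite G \<and> F \<subseteq> G \<and> G \<subseteq> E \<longrightarrow> p G y = y)"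
    if "y \<in> span {c *\<^sub>C e | c e. e \<in> E}" for y
    using that
  proof (induction rule: span_induct_alt)
    case base
    show ?case by (rule exI[of _ "{}"]) (simp add: p_def cinner.zero_right scaleC.zero_left)
  next
    case (step r z y)
    from step(1) obtain c e where z: "z = c *\<^sub>C e" "e \<in> E" by blast
    from step(2) obtain F where F: "finite F" "F \<subseteq> E" "\<And>G. finite G \<Longrightarrow> F \<subseteq> G \<Longrightarrow> G \<subseteq> E \<Longrightarrow> p G y = y"
      by (elim exE conjE) metis
    have "p G (r *\<^sub>R z + y) = r *\<^sub>R z + y" if G: "finite G" "insert e F \<subseteq> G" "G \<subseteq> E" for G
    proof -
      have "p G z = (\<Sum>f\<in>G. if f = e then z else 0)"
        unfolding p_def z(1) cinner_scaleC_right
        using z G by (intro sum.cong refl) (auto simp: onb_cinner[OF E] subset_iff scaleC.zero_left)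
      hence "p G z = z" using G by simp
      moreover have "p G (r *\<^sub>R z + y) = r *\<^sub>R p G z + p G y"
        by (simp add: p_def cinner.add_right cinner.scaleR_right scaleC.scaleR_left scaleC_add_left
            sum.distrib scaleR_sum_right)
      ultimately show ?thesis using F(3)[of G] G by simp
    qed
    thus ?case using F(1,2) z(2) by (intro exI[of _ "insert e F"]) simp
  qed
  have "\<forall>\<^sub>F G in finite_subsets_at_top E. dist (p G x) x < \<epsilon>" if "\<epsilon> > 0" for \<epsilon>
  proof -
    have "x \<in> closure (span {c *\<^sub>C e | c e. e \<in> E})" using E by (simp add: is_onb_def)
    hence "\<exists>y\<in>span {c *\<^sub>C e | c e. e \<in> E}. dist y x < \<epsilon> / 2"
      using half_gt_zero[OF that] unfolding closure_approachable by blast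
    then obtain y where y: "y \<in> span {c *\<^sub>C e | c e. e \<in> E}" "dist y x < \<epsilon> / 2" by blast
    obtain F where F: "finite F" "F \<subseteq> E" "\<And>G. finite G \<Longrightarrow> F \<subseteq> G \<Longrightarrow> G \<subseteq> E \<Longrightarrow> p G y = y"
      using ev[OF y(1)] by (elim exE conjE) metis
    have "dist (p G x) x < \<epsilon>" if G: "finite G" "F \<subseteq> G" "G \<subseteq> E" for G
    proof -
      \<comment> \<open>As \<open>p G\<close> fixes \<open>y\<close>, the error at \<open>x\<close>
        is the error at \<open>x - y\<close>, at most twice the norm of \<open>x - y\<close>; hence
        the choice of \<open>\<epsilon> / 2\<close>.\<close>
      have "p G x - x = p G (x - y) - (x - y)" using F(3)[OF G] by (simp add: p_diff)
      hence "norm (p G x - x) \<le> norm (p G (x - y)) + norm (x - y)"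
        by (metis norm_triangle_ineq4)
      also have "\<dots> \<le> 2 * norm (x - y)"
        using onb_partial_sum_bessel[OF E G(1,3), of "x - y"] by (simp add: p_def)
      also have "\<dots> < \<epsilon>" using y(2) by (simp add: dist_norm norm_minus_commute)
      finally show ?thesis by (simp add: dist_norm)
    qed
    thus ?thesis using F(1,2) unfolding eventually_finite_subsets_at_top by (intro exI[of _ F]) simp
  qed
  thus ?thesis unfolding has_sum_def tendsto_iff p_def by simp
qed

lemma onb_has_sum_cinner:
  assumes "is_onb (E::'a::chilbert_space set)"
  shows "((\<lambda>e. cinner y e * cinner e x) has_sum cinner y x) E"
  using has_sum_bounded_linear[OF cinner.bounded_linear_right onb_has_sum[OF assms], of y x]
  by (simp add: cinner_scaleC_right mult.commute)

lemma parseval: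
  assumes "is_onb (E::'a::chilbert_space set)"
  shows "((\<lambda>e. (norm (cinner e x))\<^sup>2) has_sum (norm x)\<^sup>2) E"
proof -
  have "cinner x e * cinner e x = complex_of_real ((norm (cinner e x))\<^sup>2)" for e
    by (metis cinner_commute complex_norm_square mult.commute)
  hence "((\<lambda>e. complex_of_real ((norm (cinner e x))\<^sup>2)) has_sum complex_of_real ((norm x)\<^sup>2)) E"
    using onb_has_sum_cinner[OF assms, of x x] by (simp add: cinner_self)
  thus ?thesis by (auto dest: has_sum_Re)
qed

text \<open>By Parseval both sums are iterated forms of one nonnegative double sum over
  \<open>E \<times> F\<close>. For a self-adjoint operator this is independence of the
  Hilbert-Schmidt norm from the basis.\<close>

lemma hilbert_schmidt_adjoint:
  fixes R Q :: "'a::chilbert_space \<Rightarrow> 'a"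
  assumes E: "is_onb E" and F: "is_onb F" and adj: "\<And>x y. cinner (R x) y = cinner x (Q y)"
    and sum: "((\<lambda>e. (norm (R e))\<^sup>2) has_sum s) E"
  shows "((\<lambda>f. (norm (Q f))\<^sup>2) has_sum s) F"
proof -
  have eq: "norm (cinner f (R e)) = norm (cinner e (Q f))" for e f
    by (metis adj cinner_commute complex_mod_cnj)
  have "(\<lambda>(e,f). (norm (cinner f (R e)))\<^sup>2) summable_on E \<times> F"
    by (rule summable_on_SigmaI[where g = "\<lambda>e. (norm (R e))\<^sup>2"])
      (use parseval[OF F] has_sum_imp_summable[OF sum] in auto)
  hence "((\<lambda>(e,f). (norm (cinner f (R e)))\<^sup>2) has_sum s) (E \<times> F)"
    by (intro has_sum_SigmaI[where g = "\<lambda>e. (norm (R e))\<^sup>2"])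
      (use parseval[OF F] sum in auto)
  hence "((\<lambda>(f,e). (norm (cinner e (Q f)))\<^sup>2) has_sum s) (F \<times> E)"
    by (subst (asm) has_sum_swap) (simp add: eq)
  thus ?thesis
    by (rule has_sum_SigmaD[where f = "\<lambda>(f,e). (norm (cinner e (Q f)))\<^sup>2"]) (use parseval[OF E] in auto)
qed


section \<open>Positive square roots\<close>

text \<open>Positivity is a property of the underlying real Hilbert space, so that square roots can be
  taken there; they commute with the complex structure because the operator does.\<close>

definition pos_sym :: "('a::real_inner \<Rightarrow> 'a) \<Rightarrow> bool" where
  "pos_sym T \<longleftrightarrow> bounded_linear T \<and> (\<forall>x y. inner (T x) y = inner x (T y)) \<and> (\<forall>x. inner x (T x) \<ge> 0)"

lemma pos_symD:
  assumes "pos_sym T"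
  shows "bounded_linear T" "inner (T x) y = inner x (T y)" "inner x (T x) \<ge> 0"
  using assms by (auto simp: pos_sym_def)

lemma pos_sym_cauchy_schwarz:
  assumes T: "pos_sym T"
  shows "(inner x (T y))\<^sup>2 \<le> inner x (T x) * inner y (T y)"
proof -
  interpret bounded_linear T using T by (rule pos_symD)
  define a b c where "a = inner x (T x)" and "b = inner x (T y)" and "c = inner y (T y)"
  have c0: "c \<ge> 0" using pos_symD(3)[OF T] by (simp add: c_def)
  have yx: "inner y (T x) = b" using pos_symD(2)[OF T] by (simp add: b_def inner_commute)
  have q: "0 \<le> a + 2 * t * b + t\<^sup>2 * c" for t
  proof -
    have "inner (x + t *\<^sub>R y) (T (x + t *\<^sub>R y)) = a + 2 * t * b + t\<^sup>2 * c"
      using yx by (simp add: add scaleR inner_simps a_def b_def c_def power2_eq_square algebra_simps)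
    thus ?thesis using pos_symD(3)[OF T, of "x + t *\<^sub>R y"] by simp
  qed
  have "b\<^sup>2 \<le> a * c"
  proof (cases "c = 0")
    case True
    have "b = 0"
    proof (rule ccontr)
      assume "b \<noteq> 0"
      \<comment> \<open>With \<open>c = 0\<close> the polynomial is affine in \<open>t\<close>; this
        value of \<open>t\<close> makes it equal to \<open>-1\<close>.\<close>
      hence "2 * (- (a + 1) / (2 * b)) * b = - (a + 1)" by (simp add: field_simps)
      hence "0 \<le> a - (a + 1)"
        using q[of "- (a + 1) / (2 * b)"] unfolding True by simp
      thus False by simp
    qed
    thus ?thesis using True by simp
  next
    case False
    \<comment> \<open>The quadratic is evaluated at its minimum \<open>t = - b / c\<close>; the
      factor \<open>c\<close> clears the denominator.\<close>
    have "0 \<le> c * (a + 2 * (- b / c) * b + (- b / c)\<^sup>2 * c)"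
      using q[of "- b / c"] c0 by (simp only: zero_le_mult_iff) simp
    also have "\<dots> = a * c - b\<^sup>2" using False by (simp add: field_simps power2_eq_square)
    finally show ?thesis by simp
  qed
  thus ?thesis by (simp add: a_def b_def c_def)
qed

text \<open>Cauchy-Schwarz for the form of \<open>T\<close>, taken at \<open>T y\<close> and
  \<open>y\<close>, bounds the square of \<open>inner (T y) (T y)\<close> by zero.\<close>

lemma pos_sym_eq_zero:
  assumes T: "pos_sym T" and "inner y (T y) = 0"
  shows "T y = 0"
proof -
  have "(inner (T y) (T y))\<^sup>2 \<le> 0"
    using pos_sym_cauchy_schwarz[OF T, of "T y" y] assms(2) by simp
  thus ?thesis by simp
qed


text \<open>The scalar case \<open>A = 1\<close> of the operator iteration \<open>sqrt_iter\<close>.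
  It is increasing and bounded by 1, and dominates iterates and increments whenever
  \<open>norm A \<le> 1\<close>.\<close>

primrec sqrt_majorant :: "nat \<Rightarrow> real" where
  "sqrt_majorant 0 = 0"
| "sqrt_majorant (Suc n) = (1 + (sqrt_majorant n)\<^sup>2) / 2"

text \<open>The iteration converges to \<open>1 - sqrt (1 - A)\<close>, the solution of \<open>Y = (A + Y\<^sup>2) / 2\<close>.\<close>

primrec sqrt_iter :: "('a::real_normed_vector \<Rightarrow>\<^sub>L 'a) \<Rightarrow> nat \<Rightarrow> ('a \<Rightarrow>\<^sub>L 'a)" where
  "sqrt_iter A 0 = 0"
| "sqrt_iter A (Suc n) = (1/2) *\<^sub>R (A + (sqrt_iter A n o\<^sub>L sqrt_iter A n))"

lemma sqrt_majorant_bounds: "0 \<le> sqrt_majorant n" "sqrt_majorant n \<le> 1"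
proof -
  have "0 \<le> sqrt_majorant n \<and> sqrt_majorant n \<le> 1"
    by (induction n) (simp_all add: power_le_one)
  thus "0 \<le> sqrt_majorant n" "sqrt_majorant n \<le> 1" by auto
qed

lemma sqrt_majorant_mono: "sqrt_majorant n \<le> sqrt_majorant (Suc n)"
proof -
  have "0 \<le> (1 - sqrt_majorant n)\<^sup>2" by simp
  thus ?thesis by (simp add: power2_diff)
qed

lemma norm_sqrt_iter:
  assumes "norm A \<le> 1"
  shows "norm (sqrt_iter A n) \<le> sqrt_majorant n"
proof (induction n)
  case (Suc n)
  have "norm (sqrt_iter A n o\<^sub>L sqrt_iter A n) \<le> (sqrt_majorant n)\<^sup>2"
    using norm_blinfun_compose[of "sqrt_iter A n" "sqrt_iter A n"] mult_mono[OF Suc Suc]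
      sqrt_majorant_bounds(1)[of n] by (simp add: power2_eq_square)
  thus ?case
    using assms norm_triangle_ineq[of A "sqrt_iter A n o\<^sub>L sqrt_iter A n"] by simp
qed simp

text \<open>The difference of squares is split without commuting factors as
  \<open>Y' (Y' - Y) + (Y' - Y) Y\<close>. The majorant satisfies the corresponding scalar identity,
  so the bound propagates by induction.\<close>

lemma norm_sqrt_iter_diff:
  assumes A: "norm A \<le> 1"
  shows "norm (sqrt_iter A (Suc n) - sqrt_iter A n) \<le> sqrt_majorant (Suc n) - sqrt_majorant n"
proof (induction n)
  case 0
  show ?case using A by simp
next
  case (Suc n)
  define Y Y' where "Y = sqrt_iter A n" and "Y' = sqrt_iter A (Suc n)"
  define y y' where "y = sqrt_majorant n" and "y' = sqrt_majorant (Suc n)"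
  have IH: "norm (Y' - Y) \<le> y' - y" using Suc by (simp add: Y_def Y'_def y_def y'_def)
  have Y: "norm Y \<le> y" "norm Y' \<le> y'"
    unfolding Y_def Y'_def y_def y'_def by (rule norm_sqrt_iter[OF A])+
  have "sqrt_iter A (Suc (Suc n)) - Y' = (1/2) *\<^sub>R ((Y' o\<^sub>L Y') - (Y o\<^sub>L Y))"
    by (simp add: Y_def Y'_def algebra_simps)
  also have "(Y' o\<^sub>L Y') - (Y o\<^sub>L Y) = (Y' o\<^sub>L (Y' - Y)) + ((Y' - Y) o\<^sub>L Y)"
    by (simp add: bounded_bilinear.diff_left[OF bounded_bilinear_blinfun_compose]
        bounded_bilinear.diff_right[OF bounded_bilinear_blinfun_compose])
  finally have "norm (sqrt_iter A (Suc (Suc n)) - Y')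
      = norm ((Y' o\<^sub>L (Y' - Y)) + ((Y' - Y) o\<^sub>L Y)) / 2" by simp
  also have "\<dots> \<le> (norm Y' * norm (Y' - Y) + norm (Y' - Y) * norm Y) / 2"
    by (intro divide_right_mono norm_triangle_le add_mono norm_blinfun_compose) simp
  also have "\<dots> \<le> (y' * (y' - y) + (y' - y) * y) / 2"
    using Y IH sqrt_majorant_bounds sqrt_majorant_mono
    by (intro divide_right_mono add_mono mult_mono) (simp_all add: y_def y'_def del: sqrt_majorant.simps)
  also have "\<dots> = sqrt_majorant (Suc (Suc n)) - y'"
    by (simp add: y_def y'_def field_simps power2_eq_square)
  finally show ?case by (simp only: Y'_def y'_def)
qed

text \<open>The increments are dominated by those of a bounded increasing sequence, whose
  telescoping series converges, so they are absolutely summable in operator norm.\<close>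

lemma convergent_sqrt_iter:
  fixes A :: "'a::banach \<Rightarrow>\<^sub>L 'a"
  assumes A: "norm A \<le> 1"
  shows "convergent (sqrt_iter A)"
proof -
  have "convergent sqrt_majorant"
    by (intro Bseq_monoseq_convergent incseq_imp_monoseq incseq_SucI sqrt_majorant_mono BseqI'[of _ 1])
      (simp add: sqrt_majorant_bounds)
  hence "summable (\<lambda>n. sqrt_majorant (Suc n) - sqrt_majorant n)"
    using telescope_summable unfolding convergent_def by blast
  hence "summable (\<lambda>n. sqrt_iter A (Suc n) - sqrt_iter A n)"
    by (rule summable_comparison_test') (rule norm_sqrt_iter_diff[OF A])
  hence "convergent (\<lambda>n. sqrt_iter A n - sqrt_iter A 0)"
    by (simp only: summable_iff_convergent sum_lessThan_telescope)
  thus ?thesis by simp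
qed

text \<open>For \<open>A = 1 - T\<close> the iterates converge to \<open>L\<close> with
  \<open>2 L = 1 - T + L L\<close>, so \<open>S = 1 - L\<close> squares to \<open>T\<close>.
  Symmetry and commutation pass from the iterates to the limit; positivity of \<open>S\<close> comes
  from \<open>norm L \<le> 1\<close>.\<close>

lemma pos_sym_sqrt_contraction:
  fixes T :: "'a::{real_inner,banach} \<Rightarrow> 'a"
  assumes T: "pos_sym T" and le: "\<And>x. inner x (T x) \<le> inner x x"
  shows "\<exists>S. pos_sym S \<and> (\<forall>x. S (S x) = T x) \<and>
    (\<forall>C. bounded_linear C \<longrightarrow> (\<forall>x. C (T x) = T (C x)) \<longrightarrow> (\<forall>x. C (S x) = S (C x)))"
proof -
  interpret T: bounded_linear T using T by (rule pos_symD)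
  define A where "A = Blinfun (\<lambda>x. x - T x)"
  have A: "blinfun_apply A x = x - T x" for x
    unfolding A_def
    by (subst bounded_linear_Blinfun_apply)
      (simp_all add: bounded_linear_sub[OF bounded_linear_ident T.bounded_linear_axioms])
  have A_pos: "pos_sym (blinfun_apply A)"
    using le pos_symD(2)[OF T] by (simp add: pos_sym_def blinfun.bounded_linear_right A inner_simps)
  \<comment> \<open>The form of \<open>A\<close> lies between 0 and the squared norm; its
    Cauchy-Schwarz inequality at \<open>z = A x\<close> and \<open>x\<close> turns this into a norm
    bound.\<close>
  have "norm (blinfun_apply A x) \<le> 1 * norm x" for x
  proof -
    define z where "z = blinfun_apply A x"
    have le1: "inner u (blinfun_apply A u) \<le> (norm u)\<^sup>2" for u
      using pos_symD(3)[OF T, of u] by (simp add: A inner_simps power2_norm_eq_inner)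
    have "(inner z z)\<^sup>2 \<le> inner z (blinfun_apply A z) * inner x z"
      using pos_sym_cauchy_schwarz[OF A_pos, of z x] by (simp add: z_def)
    also have "\<dots> \<le> (norm z)\<^sup>2 * (norm x)\<^sup>2"
      using le1[of z] le1[of x] pos_symD(3)[OF A_pos] by (intro mult_mono) (auto simp: z_def)
    finally have "(norm z)\<^sup>2 * (norm z)\<^sup>2 \<le> (norm z)\<^sup>2 * (norm x)\<^sup>2"
      by (simp add: power2_norm_eq_inner power2_eq_square[of "inner z z"])
    hence "(norm z)\<^sup>2 \<le> (norm x)\<^sup>2"
      by (cases "z = 0") (simp, metis mult_left_le_imp_le zero_less_norm_iff zero_less_power)
    thus ?thesis using power2_le_imp_le[of "norm z" "norm x"] by (simp add: z_def)
  qed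
  hence nA: "norm A \<le> 1" by (intro norm_blinfun_bound) simp_all
  obtain L where L: "sqrt_iter A \<longlonglongrightarrow> L"
    using convergent_sqrt_iter[OF nA] by (auto simp: convergent_def)
  have Lx: "(\<lambda>n. blinfun_apply (sqrt_iter A n) x) \<longlonglongrightarrow> blinfun_apply L x" for x
    by (intro tendsto_intros L)
  have L_commute: "C (blinfun_apply L x) = blinfun_apply L (C x)"
    if C: "bounded_linear C" "\<And>x. C (T x) = T (C x)" for C x
  proof -
    interpret C: bounded_linear C by fact
    have "C (blinfun_apply (sqrt_iter A n) x) = blinfun_apply (sqrt_iter A n) (C x)" for n x
      by (induction n arbitrary: x)
        (simp_all add: blinfun.bilinear_simps A C(2) C.zero C.add C.diff C.scaleR)
    hence "(\<lambda>n. blinfun_apply (sqrt_iter A n) (C x)) \<longlonglongrightarrow> C (blinfun_apply L x)"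
      using C.tendsto[OF Lx[of x]] by simp
    thus ?thesis using Lx[of "C x"] LIMSEQ_unique by blast
  qed
  have L_sym: "inner (blinfun_apply L x) y = inner x (blinfun_apply L y)" for x y
  proof -
    have "inner (blinfun_apply (sqrt_iter A n) x) y = inner x (blinfun_apply (sqrt_iter A n) y)" for n x y
      by (induction n arbitrary: x y) (simp_all add: blinfun.bilinear_simps inner_simps pos_symD(2)[OF A_pos])
    hence "(\<lambda>n. inner x (blinfun_apply (sqrt_iter A n) y)) \<longlonglongrightarrow> inner (blinfun_apply L x) y"
      using tendsto_inner[OF Lx[of x] tendsto_const[of y]] by simp
    moreover have "(\<lambda>n. inner x (blinfun_apply (sqrt_iter A n) y)) \<longlonglongrightarrow> inner x (blinfun_apply L y)"
      by (intro tendsto_intros L)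
    ultimately show ?thesis using LIMSEQ_unique by blast
  qed
  have L_eq: "blinfun_apply L x = (1/2) *\<^sub>R (x - T x + blinfun_apply L (blinfun_apply L x))" for x
  proof -
    have "(\<lambda>n. blinfun_apply (sqrt_iter A (Suc n)) x) \<longlonglongrightarrow> (1/2) *\<^sub>R (x - T x + blinfun_apply L (blinfun_apply L x))"
      unfolding sqrt_iter.simps blinfun.bilinear_simps A blinfun_apply_blinfun_compose
      by (intro tendsto_intros L)
    moreover have "(\<lambda>n. blinfun_apply (sqrt_iter A (Suc n)) x) \<longlonglongrightarrow> blinfun_apply L x"
      using Lx LIMSEQ_Suc by blast
    ultimately show ?thesis using LIMSEQ_unique by blast
  qed
  have "norm (sqrt_iter A n) \<le> 1" for n
    using norm_sqrt_iter[OF nA, of n] sqrt_majorant_bounds(2)[of n] by simp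
  hence nL: "norm L \<le> 1"
    using L by (intro tendsto_upperbound[OF tendsto_norm[OF L]]) auto
  define S where "S x = x - blinfun_apply L x" for x
  have "pos_sym S"
    unfolding pos_sym_def
  proof (intro conjI allI)
    show "bounded_linear S"
      unfolding S_def by (intro bounded_linear_intros)
    show "inner (S x) y = inner x (S y)" for x y
      by (simp add: S_def inner_simps L_sym)
    show "0 \<le> inner x (S x)" for x
    proof -
      have "inner x (blinfun_apply L x) \<le> norm x * norm (blinfun_apply L x)"
        by (rule norm_cauchy_schwarz)
      also have "\<dots> \<le> norm x * (norm L * norm x)"
        by (intro mult_left_mono norm_blinfun norm_ge_zero)
      also have "\<dots> \<le> norm x * (1 * norm x)"
        by (intro mult_left_mono mult_right_mono nL norm_ge_zero)
      finally show ?thesis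
        by (simp add: S_def inner_simps dot_square_norm power2_eq_square)
    qed
  qed
  moreover have "S (S x) = T x" for x
  proof -
    have "2 *\<^sub>R blinfun_apply L x = x - T x + blinfun_apply L (blinfun_apply L x)"
      by (subst L_eq) simp
    thus ?thesis
      by (simp add: S_def blinfun.bilinear_simps scaleR_2 algebra_simps)
  qed
  moreover have "C (S x) = S (C x)" if "bounded_linear C" "\<forall>x. C (T x) = T (C x)" for C x
    using L_commute[of C x] that by (simp add: S_def linear_diff bounded_linear.linear)
  ultimately show ?thesis by blast
qed

lemma pos_sym_scaleR: "pos_sym T \<Longrightarrow> 0 \<le> c \<Longrightarrow> pos_sym (\<lambda>x. c *\<^sub>R T x)"
  by (simp add: pos_sym_def bounded_linear_compose[OF bounded_linear_scaleR_right])

text \<open>Dividing by a norm bound \<open>K\<close> reduces to contractions, and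
  \<open>sqrt K\<close> undoes the scaling. The commutation clause later yields uniqueness of the
  root and its compatibility with \<open>\<i>\<close>.\<close>

theorem pos_sym_sqrt:
  fixes T :: "'a::{real_inner,banach} \<Rightarrow> 'a"
  assumes T: "pos_sym T"
  obtains S where "pos_sym S" "\<And>x. S (S x) = T x"
    "\<And>C x. bounded_linear C \<Longrightarrow> (\<And>x. C (T x) = T (C x)) \<Longrightarrow> C (S x) = S (C x)"
proof -
  interpret T: bounded_linear T using T by (rule pos_symD)
  obtain K where K: "K > 0" "\<And>x. norm (T x) \<le> norm x * K" using T.pos_bounded by blast
  have "pos_sym (\<lambda>x. (1 / K) *\<^sub>R T x)" using T K(1) by (intro pos_sym_scaleR) simp_all
  moreover have "inner x ((1 / K) *\<^sub>R T x) \<le> inner x x" for x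
  proof -
    have "inner x (T x) \<le> norm x * norm (T x)" by (rule norm_cauchy_schwarz)
    also have "\<dots> \<le> norm x * (norm x * K)" using K by (intro mult_left_mono) simp_all
    finally show ?thesis using K(1) by (simp add: field_simps dot_square_norm power2_eq_square)
  qed
  ultimately obtain S where S: "pos_sym S" "\<And>x. S (S x) = (1 / K) *\<^sub>R T x"
    "\<And>C. bounded_linear C \<Longrightarrow> (\<forall>x. C ((1 / K) *\<^sub>R T x) = (1 / K) *\<^sub>R T (C x)) \<Longrightarrow> \<forall>x. C (S x) = S (C x)"
    using pos_sym_sqrt_contraction[of "\<lambda>x. (1 / K) *\<^sub>R T x"] by blast
  interpret S: bounded_linear S using S(1) by (rule pos_symD)
  show ?thesis
  proof
    show "pos_sym (\<lambda>x. sqrt K *\<^sub>R S x)" using S(1) K(1) by (intro pos_sym_scaleR) simp_all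
    show "sqrt K *\<^sub>R S (sqrt K *\<^sub>R S x) = T x" for x
      using K(1) by (simp add: S.scaleR S(2))
    fix C :: "'a \<Rightarrow> 'a" and x
    assume "bounded_linear C" "\<And>x. C (T x) = T (C x)"
    thus "C (sqrt K *\<^sub>R S x) = sqrt K *\<^sub>R S (C x)"
      using S(3)[of C] by (simp add: linear_scale bounded_linear.linear)
  qed
qed

text \<open>The constructed root \<open>S\<close> commutes with any positive root \<open>Q\<close>,
  since \<open>Q\<close> commutes with its own square. Then \<open>S + Q\<close> annihilates
  \<open>d = S x - Q x\<close>, positivity makes \<open>S d\<close> and \<open>Q d\<close> vanish
  separately, and so \<open>inner d d = inner x (S d - Q d)\<close> is zero. Both \<open>P\<close>
  and \<open>T\<close> therefore equal \<open>S\<close>.\<close>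

theorem pos_sym_sqrt_unique:
  fixes P T :: "'a::{real_inner,banach} \<Rightarrow> 'a"
  assumes P: "pos_sym P" and T: "pos_sym T" and eq: "\<And>x. P (P x) = T (T x)"
  shows "P = T"
proof -
  have sq: "pos_sym (\<lambda>x. T (T x))"
    unfolding pos_sym_def
    using pos_symD(1,2)[OF T] bounded_linear_compose[OF pos_symD(1,1)[OF T]]
    by (metis inner_ge_zero)
  obtain S where S: "pos_sym S" "\<And>x. S (S x) = T (T x)"
    "\<And>C x. bounded_linear C \<Longrightarrow> (\<And>x. C (T (T x)) = T (T (C x))) \<Longrightarrow> C (S x) = S (C x)"
    using pos_sym_sqrt[OF sq] by blast
  have "S x = Q x" if Q: "pos_sym Q" "\<And>x. Q (Q x) = T (T x)" for Q x
  proof -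
    interpret S: bounded_linear S using S(1) by (rule pos_symD)
    interpret Q: bounded_linear Q using Q(1) by (rule pos_symD)
    have comm: "Q (S x) = S (Q x)" for x
      by (rule S(3)[OF Q.bounded_linear_axioms]) (metis Q(2))
    define d where "d = S x - Q x"
    have "S d + Q d = 0"
      by (simp add: d_def S.diff Q.diff S(2) Q(2) comm)
    hence "inner d (S d) + inner d (Q d) = 0"
      by (metis inner_add_right inner_zero_right)
    hence "inner d (S d) = 0" "inner d (Q d) = 0"
      using pos_symD(3)[OF S(1), of d] pos_symD(3)[OF Q(1), of d] by linarith+
    hence "S d = 0" "Q d = 0" using pos_sym_eq_zero[OF S(1)] pos_sym_eq_zero[OF Q(1)] by blast+
    moreover have "inner d d = inner x (S d - Q d)"
      unfolding d_def by (simp add: inner_diff_left inner_diff_right S.diff Q.diff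
          pos_symD(2)[OF S(1)] pos_symD(2)[OF Q(1)])
    ultimately have "d = 0" by simp
    thus ?thesis by (simp add: d_def)
  qed
  from this[OF P eq] this[OF T] show ?thesis by fastforce
qed


section \<open>Positive operators\<close>

lemma bounded_clinearD:
  assumes "bounded_clinear T"
  shows "bounded_linear T" "T (c *\<^sub>C x) = c *\<^sub>C T x"
  using assms by (auto simp: bounded_clinear_def)

lemma projection_opD:
  assumes "projection_op P"
  shows "bounded_clinear P" "P (P x) = P x" "cinner (P x) y = cinner x (P y)"
    "inner (P x) y = inner x (P y)"
  using assms by (auto simp: projection_op_def inner_Re_cinner fun_eq_iff)

lemma projection_op_pos_sym:
  assumes P: "projection_op P"
  shows "pos_sym P"
  unfolding pos_sym_def
proof (intro conjI allI)
  show "bounded_linear P" using projection_opD(1)[OF P] by (rule bounded_clinearD)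
  show "inner (P x) y = inner x (P y)" for x y by (rule projection_opD[OF P])
  show "0 \<le> inner x (P x)" for x
    using projection_opD(4)[OF P, of x "P x"] inner_ge_zero[of "P x"]
    by (simp add: projection_opD(2)[OF P])
qed

text \<open>Symmetry comes from polarizing the vanishing imaginary part of the quadratic form at
  \<open>x + \<i> *\<^sub>C y\<close>.\<close>

lemma positive_op_pos_sym:
  assumes T: "positive_op T"
  shows "pos_sym T"
proof -
  have lin: "bounded_clinear T" and pos: "cinner x (T x) \<in> \<real>\<^sub>\<ge>\<^sub>0" for x
    using T by (auto simp: positive_op_def)
  interpret T: bounded_linear T using lin by (rule bounded_clinearD)
  have im: "inner x (\<i> *\<^sub>C T x) = 0" for x
    using pos[of x] by (simp add: complex_nonneg_Reals_iff Im_cinner)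
  have ii: "\<i> *\<^sub>C \<i> *\<^sub>C w = - w" for w :: 'a
    by (simp add: scaleC_scaleC scaleC.minus_left scaleC_one)
  have "inner x (T y) = inner y (T x)" for x y
  proof -
    have "inner (x + \<i> *\<^sub>C y) (\<i> *\<^sub>C T (x + \<i> *\<^sub>C y)) = 0" by (rule im)
    hence "inner x (\<i> *\<^sub>C \<i> *\<^sub>C T y) + inner (\<i> *\<^sub>C y) (\<i> *\<^sub>C T x) = 0"
      using im[of x] im[of "\<i> *\<^sub>C y"]
      by (simp add: T.add scaleC_add_right inner_add_left inner_add_right bounded_clinearD(2)[OF lin])
    moreover have "inner (\<i> *\<^sub>C y) (\<i> *\<^sub>C T x) = inner y (T x)"
      by (simp add: inner_Re_cinner cinner_scaleC_left cinner_scaleC_right)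
    ultimately show ?thesis by (simp add: ii)
  qed
  thus ?thesis
    using pos by (simp add: pos_sym_def T.bounded_linear_axioms complex_nonneg_Reals_iff
        inner_Re_cinner[symmetric] inner_commute)
qed

lemma positive_op_add:
  assumes "positive_op S" "positive_op T"
  shows "positive_op (\<lambda>x. S x + T x)"
  using assms unfolding positive_op_def bounded_clinear_def
  by (auto simp: bounded_linear_add scaleC_add_right cinner_add_right nonneg_Reals_add_I)

lemma positive_op_scaleR:
  assumes "positive_op T" "0 \<le> r"
  shows "positive_op (\<lambda>x. r *\<^sub>R T x)"
  using assms unfolding positive_op_def bounded_clinear_def
  by (auto simp: bounded_linear_compose[OF bounded_linear_scaleR_right] scaleC_scaleR
      cinner.scaleR_right complex_nonneg_Reals_iff)

lemma positive_op_id: "positive_op (\<lambda>x. x)"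
  by (simp add: positive_op_def bounded_clinear_def bounded_linear_ident cinner_self)


section \<open>Traces of positive trace class operators\<close>

text \<open>By uniqueness of positive roots a positive \<open>T\<close> is its own absolute value,
  so the summable diagonal in the given basis consists of the squared norms of \<open>S e\<close>.
  As \<open>S\<close> is its own adjoint, the sum carries over to \<open>F\<close>.\<close>

lemma trace_class_sqrt_hilbert_schmidt:
  fixes T :: "'a::chilbert_space \<Rightarrow> 'a"
  assumes T: "trace_class T" "positive_op T" and F: "is_onb F"
  obtains S s where "pos_sym S" "\<And>x. S (S x) = T x" "\<And>x. S (\<i> *\<^sub>C x) = \<i> *\<^sub>C S x"
    "((\<lambda>e. (norm (S e))\<^sup>2) has_sum s) F"
proof -
  have T_ps: "pos_sym T" by (rule positive_op_pos_sym) fact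
  have lin: "bounded_clinear T" using T by (simp add: positive_op_def)
  obtain P E where P: "is_abs_op T P" and E: "is_onb E" and sum: "(\<lambda>e. cinner e (P e)) summable_on E"
    using T(1) by (auto simp: trace_class_def)
  have P_ps: "pos_sym P" using P by (auto simp: is_abs_op_def intro: positive_op_pos_sym)
  have "P (P y) = T (T y)" for y
  proof -
    have "inner x (P (P y)) = inner x (T (T y))" for x
      using P pos_symD(2)[OF T_ps] by (simp add: is_abs_op_def inner_Re_cinner)
    thus ?thesis using vector_eq_ldot by blast
  qed
  hence PT: "P = T" by (rule pos_sym_sqrt_unique[OF P_ps T_ps])
  obtain S where S: "pos_sym S" "\<And>x. S (S x) = T x"
    and comm: "\<And>C x. bounded_linear C \<Longrightarrow> (\<And>x. C (T x) = T (C x)) \<Longrightarrow> C (S x) = S (C x)"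
    using pos_sym_sqrt[OF T_ps] by blast
  have S_i: "S (\<i> *\<^sub>C x) = \<i> *\<^sub>C S x" for x
    by (rule comm[symmetric]) (simp_all add: scaleC.bounded_linear_right bounded_clinearD(2)[OF lin])
  have S_sym: "cinner (S x) y = cinner x (S y)" for x y
    by (rule cinner_symmetric) (simp_all add: pos_symD(2)[OF S(1)] S_i)
  have "cinner e (P e) = complex_of_real ((norm (S e))\<^sup>2)" for e
    by (simp only: PT S(2)[symmetric] S_sym[symmetric] cinner_self)
  hence "((\<lambda>e. complex_of_real ((norm (S e))\<^sup>2)) has_sum infsum (\<lambda>e. cinner e (P e)) E) E"
    using has_sum_infsum[OF sum] by simp
  hence "((\<lambda>e. (norm (S e))\<^sup>2) has_sum Re (infsum (\<lambda>e. cinner e (P e)) E)) E"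
    by (auto dest: has_sum_Re)
  from hilbert_schmidt_adjoint[OF E F S_sym this] S S_i that show ?thesis by blast
qed

text \<open>Formally the trace of \<open>Z S S\<close> is that of \<open>S Z Z S\<close>, a squared
  Hilbert-Schmidt norm and so nonnegative. Single terms \<open>cinner e (Z (T e))\<close> need not
  be real, so cyclicity is replaced by comparing Hilbert-Schmidt norms.\<close>

lemma trace_class_projection_has_sum:
  fixes T Z :: "'a::chilbert_space \<Rightarrow> 'a"
  assumes T: "trace_class T" "positive_op T" and F: "is_onb F" and Z: "projection_op Z"
  obtains s where "((\<lambda>e. cinner e (Z (T e))) has_sum s) F" "0 \<le> Re s"
proof -
  obtain S s where S: "pos_sym S" "\<And>x. S (S x) = T x" "\<And>x. S (\<i> *\<^sub>C x) = \<i> *\<^sub>C S x"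
    and s: "((\<lambda>e. (norm (S e))\<^sup>2) has_sum s) F"
    using trace_class_sqrt_hilbert_schmidt[OF T F] by blast
  have S_sym: "cinner (S x) y = cinner x (S y)" for x y
    by (rule cinner_symmetric) (simp_all add: pos_symD(2)[OF S(1)] S(3))
  interpret S: bounded_linear S using S(1) by (rule pos_symD)
  have Z_norm: "norm (Z x) \<le> norm x" for x
  proof -
    have "norm (Z x) * norm (Z x) \<le> norm x * norm (Z x)"
      using norm_cauchy_schwarz[of x "Z x"] projection_opD(4)[OF Z, of x "Z x"]
      by (simp add: projection_opD(2)[OF Z] dot_square_norm power2_eq_square)
    thus ?thesis by (cases "Z x = 0") simp_all
  qed
  \<comment> \<open>The contraction \<open>Z\<close> keeps \<open>S\<close> Hilbert-Schmidt; passing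
    to the adjoint then gives the same for \<open>S Z\<close>.\<close>
  have "(\<lambda>e. (norm (Z (S e)))\<^sup>2) summable_on F"
    by (rule summable_on_comparison_test[OF has_sum_imp_summable[OF s]])
      (simp_all add: power_mono Z_norm)
  then obtain s' where s': "((\<lambda>e. (norm (Z (S e)))\<^sup>2) has_sum s') F"
    by (auto simp: summable_on_def)
  have SZ: "((\<lambda>e. (norm (S (Z e)))\<^sup>2) has_sum s') F"
    by (rule hilbert_schmidt_adjoint[OF F F _ s']) (simp add: projection_opD(3)[OF Z] S_sym)
  text \<open>The symmetry \<open>U = 2Z - 1\<close> is unitary, hence \<open>S U\<close> has the same Hilbert-Schmidt norm
    as \<open>S\<close>; by polarization this makes the real part of the trace of \<open>Z T\<close> equal to the squared
    Hilbert-Schmidt norm of \<open>S Z\<close>.\<close>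
  define U where "U x = 2 *\<^sub>R Z x - x" for x
  have "(norm (U x))\<^sup>2 = (norm x)\<^sup>2" for x
    using projection_opD(4)[OF Z, of x "Z x"]
    by (simp add: U_def power2_norm_eq_inner inner_diff_left inner_diff_right
        projection_opD(2)[OF Z] inner_commute algebra_simps)
  hence US: "((\<lambda>e. (norm (U (S e)))\<^sup>2) has_sum s) F" using s by simp
  have SU: "((\<lambda>e. (norm (S (U e)))\<^sup>2) has_sum s) F"
    by (rule hilbert_schmidt_adjoint[OF F F _ US])
      (simp add: U_def cinner.diff_left cinner.diff_right cinner.scaleR_left cinner.scaleR_right
        S.diff S.scaleR projection_opD(3)[OF Z] S_sym)
  have eq: "cinner e (Z (T e)) = cinner (S (Z e)) (S e)" for e
    by (simp add: S(2)[symmetric] projection_opD(3)[OF Z, symmetric] S_sym)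
  have "(\<lambda>e. norm (cinner e (Z (T e)))) summable_on F"
  proof (rule summable_on_comparison_test)
    show "(\<lambda>e. (norm (S (Z e)))\<^sup>2 + (norm (S e))\<^sup>2) summable_on F"
      by (intro summable_on_add has_sum_imp_summable[OF SZ] has_sum_imp_summable[OF s])
    fix e
    have "norm (cinner e (Z (T e))) \<le> norm (S (Z e)) * norm (S e)"
      unfolding eq by (rule norm_cinner_le)
    also have "\<dots> \<le> (norm (S (Z e)))\<^sup>2 + (norm (S e))\<^sup>2"
      using sum_squares_bound[of "norm (S (Z e))" "norm (S e)"]
        mult_nonneg_nonneg[OF norm_ge_zero[of "S (Z e)"] norm_ge_zero[of "S e"]] by linarith
    finally show "norm (cinner e (Z (T e))) \<le> (norm (S (Z e)))\<^sup>2 + (norm (S e))\<^sup>2" .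
  qed simp
  hence "(\<lambda>e. cinner e (Z (T e))) summable_on F" by (rule abs_summable_summable)
  then obtain z where z: "((\<lambda>e. cinner e (Z (T e))) has_sum z) F"
    by (auto simp: summable_on_def)
  \<comment> \<open>With \<open>a = S (Z e)\<close> and \<open>b = S e\<close> one has
    \<open>S (U e) = 2 a - b\<close>; expanding its squared norm and solving for
    \<open>inner a b\<close> gives the coefficients. After summation the two quarters
    cancel.\<close>
  have "Re (cinner e (Z (T e))) = (norm (S (Z e)))\<^sup>2 + (1/4) * (norm (S e))\<^sup>2 + (- (1/4)) * (norm (S (U e)))\<^sup>2"
    for e
    unfolding eq inner_Re_cinner[symmetric] U_def power2_norm_eq_inner
    by (simp add: S.diff S.scaleR inner_diff_left inner_diff_right inner_commute algebra_simps)
  moreover have "((\<lambda>e. (norm (S (Z e)))\<^sup>2 + (1/4) * (norm (S e))\<^sup>2 + (- (1/4)) * (norm (S (U e)))\<^sup>2)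
      has_sum (s' + (1/4) * s + (- (1/4)) * s)) F"
    by (intro has_sum_add has_sum_cmult_right SZ s SU)
  ultimately have "Re z = s'"
    using has_sum_Re[OF z] has_sum_unique by fastforce
  moreover have "0 \<le> s'" using s' by (rule has_sum_nonneg) simp
  ultimately show ?thesis using that[OF z] by simp
qed


section \<open>Traces in the chosen basis and rank one operators\<close>

abbreviation trace_basis :: "'a::chilbert_space set" where
  "trace_basis \<equiv> SOME E. is_onb E"

lemma is_onb_trace_basis:
  "countable_dimension TYPE('a::chilbert_space) \<Longrightarrow> is_onb (trace_basis :: 'a set)"
  unfolding countable_dimension_def by (rule someI_ex) blast

lemma trace_eqI: "((\<lambda>e. cinner e (T e)) has_sum t) trace_basis \<Longrightarrow> trace T = t"
  by (simp add: trace_def infsumI)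

lemma trace_projection:
  fixes T Z :: "'a::chilbert_space \<Rightarrow> 'a"
  assumes "countable_dimension TYPE('a)" and T: "trace_class T" "positive_op T" and Z: "projection_op Z"
  shows "((\<lambda>e. cinner e (Z (T e))) has_sum trace (Z \<circ> T)) trace_basis" "0 \<le> Re (trace (Z \<circ> T))"
proof -
  obtain s where s: "((\<lambda>e. cinner e (Z (T e))) has_sum s) trace_basis" "0 \<le> Re s"
    using trace_class_projection_has_sum[OF T is_onb_trace_basis[OF assms(1)] Z] by blast
  have "trace (Z \<circ> T) = s" by (rule trace_eqI) (use s in simp)
  thus "((\<lambda>e. cinner e (Z (T e))) has_sum trace (Z \<circ> T)) trace_basis" "0 \<le> Re (trace (Z \<circ> T))"
    using s by simp_all
qed

text \<open>The ket-bra of a vector of arbitrary norm, so that it depends quadratically on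
  \<open>\<psi>\<close>.\<close>

definition rank_one :: "'a::chilbert_space \<Rightarrow> 'a \<Rightarrow> 'a" where
  "rank_one \<psi> x = cinner \<psi> x *\<^sub>C \<psi>"

lemma positive_op_rank_one: "positive_op (rank_one \<psi>)"
  unfolding positive_op_def bounded_clinear_def
proof (intro conjI allI)
  show "bounded_linear (rank_one \<psi>)"
    unfolding rank_one_def
    by (rule bounded_linear_compose[OF scaleC.bounded_linear_left cinner.bounded_linear_right])
  show "rank_one \<psi> (c *\<^sub>C x) = c *\<^sub>C rank_one \<psi> x" for c x
    by (simp add: rank_one_def cinner_scaleC_right scaleC_scaleC)
  show "cinner x (rank_one \<psi> x) \<in> \<real>\<^sub>\<ge>\<^sub>0" for x
    using cinner_commute[of x \<psi>]
    by (simp add: rank_one_def cinner_scaleC_right complex_norm_square[symmetric]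
        del: of_real_power)
qed

lemma trace_class_rank_one:
  assumes "countable_dimension TYPE('a::chilbert_space)"
  shows "trace_class (rank_one (\<psi>::'a))"
proof -
  have "is_abs_op (rank_one \<psi>) (rank_one \<psi>)"
    by (simp add: is_abs_op_def positive_op_rank_one)
      (simp add: rank_one_def cinner_scaleC_left cinner_scaleC_right cinner_commute[symmetric])
  moreover have "(\<lambda>e. cinner e (rank_one \<psi> e)) summable_on (trace_basis :: 'a set)"
    using onb_has_sum_cinner[OF is_onb_trace_basis[OF assms], of \<psi> \<psi>]
    by (auto simp: rank_one_def cinner_scaleC_right summable_on_def)
  ultimately show ?thesis
    using positive_op_rank_one is_onb_trace_basis[OF assms]
    unfolding trace_class_def positive_op_def by blast
qed

text \<open>Testing with rank one operators turns the trace equations of \<open>adjoint_maps\<close>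
  into equations between quadratic forms.\<close>

lemma trace_compose_rank_one:
  assumes "countable_dimension TYPE('a::chilbert_space)" and "bounded_clinear X"
  shows "trace (X \<circ> rank_one (\<psi>::'a)) = cinner \<psi> (X \<psi>)"
  using onb_has_sum_cinner[OF is_onb_trace_basis[OF assms(1)], of \<psi> "X \<psi>"]
  by (intro trace_eqI) (simp add: rank_one_def bounded_clinearD(2)[OF assms(2)] cinner_scaleC_right)

text \<open>The factor 2 is absorbed into the vectors, so that both sides are sums of two rank one
  operators and additivity of an operation applies to each.\<close>

lemma rank_one_parallelogram:
  "rank_one (\<phi> + \<psi>) x + rank_one (\<phi> - \<psi>) x
    = rank_one (sqrt 2 *\<^sub>R \<phi>) x + rank_one (sqrt 2 *\<^sub>R \<psi>) x"
proof -
  have "rank_one (sqrt 2 *\<^sub>R \<theta>) x = 2 *\<^sub>R rank_one \<theta> x" for \<theta> :: 'a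
    by (simp add: rank_one_def cinner.scaleR_left scaleC.scaleR_left scaleC_scaleR)
  thus ?thesis
    by (simp add: rank_one_def cinner.add_left cinner.diff_left scaleC.add_left scaleC.add_right
        scaleC.diff_left scaleC.diff_right scaleR_2)
qed


section \<open>Nondisturbing instruments\<close>

text \<open>Positivity is complete positivity for \<open>1 \<times> 1\<close> blocks.\<close>

lemma completely_positive_positive_op:
  assumes "trace_class_linear \<Phi>" "completely_positive \<Phi>" "trace_class Y" "positive_op Y"
  shows "trace_class (\<Phi> Y)" "positive_op (\<Phi> Y)"
proof -
  show tc: "trace_class (\<Phi> Y)" using assms by (simp add: trace_class_linear_def)
  have "block_positive (Suc 0) (\<lambda>i j. Y)"
    using assms(4) by (simp add: block_positive_def positive_op_def)
  hence "block_positive (Suc 0) (\<lambda>i j. \<Phi> Y)"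
    using assms(2)[unfolded completely_positive_def, THEN spec, THEN spec, of "Suc 0" "\<lambda>i j. Y"] assms(3)
    by simp
  hence "cinner \<psi> (\<Phi> Y \<psi>) \<in> \<real>\<^sub>\<ge>\<^sub>0" for \<psi>
    unfolding block_positive_def by (elim allE[of _ "\<lambda>_. \<psi>"]) simp
  thus "positive_op (\<Phi> Y)" using tc by (simp add: positive_op_def trace_class_def)
qed

text \<open>The parallelogram law of rank one operators passes through the linear map
  \<open>\<Phi>\<close> and then through the trace, which is additive here because the diagonal sums
  for \<open>Z\<close> converge.\<close>

lemma trace_projection_parallelogram:
  fixes Z :: "'a::chilbert_space \<Rightarrow> 'a"
  assumes dim: "countable_dimension TYPE('a)"
    and \<Phi>: "trace_class_linear \<Phi>" "completely_positive \<Phi>" and Z: "projection_op Z"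
  defines "q \<equiv> \<lambda>\<psi>. Re (trace (Z \<circ> \<Phi> (rank_one \<psi>)))"
  shows "q (\<phi> + \<psi>) + q (\<phi> - \<psi>) = 2 * q \<phi> + 2 * q \<psi>"
proof -
  have Z_lin: "bounded_clinear Z" using Z by (rule projection_opD)
  interpret Z: bounded_linear Z using Z_lin by (rule bounded_clinearD)
  note tc = trace_class_rank_one[OF dim]
  have sums: "((\<lambda>e. cinner e (Z (\<Phi> (rank_one \<psi>) e))) has_sum trace (Z \<circ> \<Phi> (rank_one \<psi>))) trace_basis" for \<psi>
    by (rule trace_projection[OF dim completely_positive_positive_op[OF \<Phi> tc positive_op_rank_one] Z])
  have add: "trace (Z \<circ> \<Phi> (\<lambda>x. rank_one \<phi> x + rank_one \<psi> x))
      = trace (Z \<circ> \<Phi> (rank_one \<phi>)) + trace (Z \<circ> \<Phi> (rank_one \<psi>))" for \<phi> \<psi>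
  proof (rule trace_eqI)
    have "\<Phi> (\<lambda>x. rank_one \<phi> x + rank_one \<psi> x) = (\<lambda>x. \<Phi> (rank_one \<phi>) x + \<Phi> (rank_one \<psi>) x)"
      using \<Phi>(1) tc unfolding trace_class_linear_def by blast
    thus "((\<lambda>e. cinner e ((Z \<circ> \<Phi> (\<lambda>x. rank_one \<phi> x + rank_one \<psi> x)) e)) has_sum
        (trace (Z \<circ> \<Phi> (rank_one \<phi>)) + trace (Z \<circ> \<Phi> (rank_one \<psi>)))) trace_basis"
      using has_sum_add[OF sums sums] by (simp add: Z.add cinner.add_right)
  qed
  have scale: "trace (Z \<circ> \<Phi> (rank_one (sqrt 2 *\<^sub>R \<psi>))) = 2 * trace (Z \<circ> \<Phi> (rank_one \<psi>))" for \<psi>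
  proof (rule trace_eqI)
    have "rank_one (sqrt 2 *\<^sub>R \<psi>) = (\<lambda>x. 2 *\<^sub>C rank_one \<psi> x)"
      by (simp add: rank_one_def fun_eq_iff cinner.scaleR_left scaleC.scaleR_left scaleC_scaleR
          scaleR_scaleC[of 2])
    hence "\<Phi> (rank_one (sqrt 2 *\<^sub>R \<psi>)) = (\<lambda>x. 2 *\<^sub>C \<Phi> (rank_one \<psi>) x)"
      using \<Phi>(1) tc unfolding trace_class_linear_def by metis
    thus "((\<lambda>e. cinner e ((Z \<circ> \<Phi> (rank_one (sqrt 2 *\<^sub>R \<psi>))) e)) has_sum
        2 * trace (Z \<circ> \<Phi> (rank_one \<psi>))) trace_basis"
      using has_sum_cmult_right[OF sums, of 2]
      by (simp add: bounded_clinearD(2)[OF Z_lin] cinner_scaleC_right)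
  qed
  have "Re (trace (Z \<circ> \<Phi> (rank_one (\<phi> + \<psi>))) + trace (Z \<circ> \<Phi> (rank_one (\<phi> - \<psi>))))
      = Re (2 * trace (Z \<circ> \<Phi> (rank_one \<phi>)) + 2 * trace (Z \<circ> \<Phi> (rank_one \<psi>)))"
    unfolding add[symmetric] scale[symmetric] rank_one_parallelogram ..
  thus ?thesis by (simp add: q_def)
qed

text \<open>Along the line in direction \<open>\<phi>\<close> the parallelogram law makes \<open>q\<close> affine on the integers,
  and a nonnegative affine sequence on the integers is constant.\<close>

lemma parallelogram_null_vector:
  fixes q :: "'a::real_vector \<Rightarrow> real"
  assumes nonneg: "\<And>x. 0 \<le> q x" and par: "\<And>x y. q (x + y) + q (x - y) = 2 * q x + 2 * q y"
    and null: "q \<phi> = 0"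
  shows "q (\<psi> + \<phi>) = q \<psi>"
proof -
  have le: "q \<psi> \<le> q (\<psi> + \<phi>)" if null: "q \<phi> = 0" for \<phi>
  proof (rule ccontr)
    define d where "d = q \<psi> - q (\<psi> + \<phi>)"
    assume "\<not> q \<psi> \<le> q (\<psi> + \<phi>)"
    hence d: "d > 0" by (simp add: d_def)
    have affine: "q (\<psi> + real n *\<^sub>R \<phi>) = q \<psi> - real n * d \<and>
        q (\<psi> + real (Suc n) *\<^sub>R \<phi>) = q \<psi> - real (Suc n) * d" for n
    proof (induction n)
      case 0
      show ?case by (simp add: d_def)
    next
      case (Suc n)
      have step: "\<psi> + real (Suc n) *\<^sub>R \<phi> + \<phi> = \<psi> + real (Suc (Suc n)) *\<^sub>R \<phi>"
        "\<psi> + real (Suc n) *\<^sub>R \<phi> - \<phi> = \<psi> + real n *\<^sub>R \<phi>"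
        by (simp_all add: scaleR_left_distrib scaleR_2)
      have "q (\<psi> + real (Suc (Suc n)) *\<^sub>R \<phi>) + q (\<psi> + real n *\<^sub>R \<phi>) = 2 * q (\<psi> + real (Suc n) *\<^sub>R \<phi>)"
        using par[of "\<psi> + real (Suc n) *\<^sub>R \<phi>" \<phi>] unfolding step null by simp
      thus ?case using Suc by (simp add: algebra_simps)
    qed
    obtain n where "q \<psi> < real n * d" using reals_Archimedean3[OF d] by blast
    thus False using affine[of n] nonneg[of "\<psi> + real n *\<^sub>R \<phi>"] by simp
  qed
  \<comment> \<open>The law at zero gives \<open>q 0 = 0\<close>, hence \<open>q\<close> is even at
    \<open>\<phi>\<close>. So \<open>q (\<psi> + \<phi>)\<close> and
    \<open>q (\<psi> - \<phi>)\<close> are both at least \<open>q \<psi>\<close>, while they add up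
    to \<open>2 * q \<psi>\<close>.\<close>
  have "q (- \<phi>) = 0"
    using par[of 0 \<phi>] par[of 0 0] null by (simp flip: scaleR_2)
  hence "q \<psi> \<le> q (\<psi> - \<phi>)" using le[of "- \<phi>"] by simp
  with le[OF null] par[of \<psi> \<phi>] null show ?thesis by simp
qed


section \<open>Two-outcome observables and commutation\<close>

lemma binary_observable_sum:
  assumes "observable {1, 2::nat} A"
  shows "A 1 x + A 2 x = x"
proof -
  have "((\<lambda>i. A i x) has_sum x) {1, 2}" using assms by (simp add: observable_def)
  hence "(\<Sum>i\<in>{1, 2}. A i x) = x" by (simp add: has_sum_finite_iff)
  thus ?thesis by simp
qed

lemma sharp_binaryD:
  assumes "observable {1, 2} A" "sharp {1, 2} A"
  shows "projection_op (A 1)" "projection_op (A (2::nat))" "A 1 x + A 2 x = x"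
proof -
  show "projection_op (A 1)" "projection_op (A 2)" using assms(2) by (simp_all add: sharp_def)
  show "A 1 x + A 2 x = x" by (rule binary_observable_sum) fact
qed

lemma pos_sym_unsharp:
  assumes "pos_sym (A 1)" "pos_sym (A 2)" "0 \<le> \<mu>" "\<mu> \<le> 1"
  shows "pos_sym (unsharp \<mu> A i)"
proof -
  have "pos_sym (\<lambda>x. a *\<^sub>R A 1 x + b *\<^sub>R A 2 x)" if "0 \<le> a" "0 \<le> b" for a b
    using pos_sym_scaleR[OF assms(1) that(1)] pos_sym_scaleR[OF assms(2) that(2)]
    unfolding pos_sym_def by (auto simp: bounded_linear_add inner_add_left inner_add_right)
  thus ?thesis using assms(3,4) by (simp add: unsharp_def)
qed

text \<open>The kernels of \<open>P\<close> and \<open>Q\<close> are the ranges of \<open>Q\<close>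
  and \<open>P\<close>, so \<open>orth\<close> says that \<open>M\<close> has no off-diagonal
  blocks: \<open>Q M P = 0\<close> and \<open>P M Q = 0\<close>. Hence
  \<open>P M = P M P = M P\<close>.\<close>

lemma complementary_projections_commute:
  assumes P: "projection_op P" and Q: "projection_op Q" and PQ: "\<And>x. P x + Q x = x"
    and M: "pos_sym M" and orth: "\<And>\<phi> \<psi>. P \<phi> = 0 \<Longrightarrow> Q \<psi> = 0 \<Longrightarrow> inner \<phi> (M \<psi>) = 0"
  shows "P (M x) = M (P x)"
proof -
  interpret P: bounded_linear P using projection_opD(1)[OF P] by (rule bounded_clinearD)
  interpret Q: bounded_linear Q using projection_opD(1)[OF Q] by (rule bounded_clinearD)
  interpret M: bounded_linear M using M by (rule pos_symD)
  have PQ0: "P (Q x) = 0" for x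
    using PQ[of "Q x"] by (simp add: projection_opD(2)[OF Q])
  have QP0: "Q (P x) = 0" for x
    using PQ[of "P x"] by (simp add: projection_opD(2)[OF P])
  have "inner (Q (M (P x))) (Q (M (P x))) = 0"
    using orth[OF PQ0 QP0, of "M (P x)" x] projection_opD(4)[OF Q, of "Q (M (P x))" "M (P x)"]
    by (simp add: projection_opD(2)[OF Q])
  hence "M (P x) = P (M (P x))" using PQ[of "M (P x)"] by simp
  moreover have "inner (P (M (Q x))) (P (M (Q x))) = 0"
    using orth[OF PQ0 QP0, of x "M (Q x)"] pos_symD(2)[OF M, of "Q x" "P (M (Q x))"]
      projection_opD(4)[OF P, of "M (Q x)" "P (M (Q x))"]
    by (simp add: projection_opD(2)[OF P])
  hence "P (M (Q x)) = 0" by simp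
  hence "P (M x) = P (M (P x))"
    using PQ[of x] by (metis M.add P.add add.right_neutral)
  ultimately show ?thesis by simp
qed

text \<open>In the proof, \<open>q i (B j)\<close> is the quadratic form of the image of \<open>B j\<close> under the dual of the
  operation \<open>I i\<close>; nondisturbance forces it to vanish on the kernel of \<open>B j\<close>.\<close>

lemma nondisturbing_effect_commutes:
  fixes A B :: "nat \<Rightarrow> 'a::chilbert_space \<Rightarrow> 'a"
  assumes dim: "countable_dimension TYPE('a)"
    and B: "observable {1, 2} B" "sharp {1, 2} B" and A: "pos_sym (A 1)"
    and I: "implementing_instrument {1, 2} A I" and \<nu>: "\<nu> \<noteq> 1/2"
    and nd: "\<And>y. y \<in> {1, 2} \<Longrightarrow> adjoint_maps (total_map {1, 2} I) (unsharp \<nu> B y) (unsharp \<nu> B y)"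
  shows "B 1 (A 1 x) = A 1 (B 1 x)"
proof -
  note P = sharp_binaryD(1)[OF B] and Q = sharp_binaryD(2)[OF B] and PQ = sharp_binaryD(3)[OF B]
  note tc = trace_class_rank_one[OF dim]
  interpret P: bounded_linear "B 1" using projection_opD(1)[OF P] by (rule bounded_clinearD)
  interpret Q: bounded_linear "B 2" using projection_opD(1)[OF Q] by (rule bounded_clinearD)
  have \<Phi>: "trace_class_linear (I i)" "completely_positive (I i)" "adjoint_maps (I i) id (A i)"
    if "i \<in> {1, 2}" for i
    using I that unfolding implementing_instrument_def by blast+
  define q where "q i Z \<psi> = Re (trace (Z \<circ> I i (rank_one \<psi>)))" for i and Z :: "'a \<Rightarrow> 'a" and \<psi>
  have q: "0 \<le> q i Z \<psi>" if "i \<in> {1, 2}" "projection_op Z" for i Z \<psi>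
    unfolding q_def
    by (rule trace_projection(2)[OF dim completely_positive_positive_op[OF \<Phi>(1,2)[OF that(1)] tc
          positive_op_rank_one] that(2)])
  have q_par: "q i Z (\<phi> + \<psi>) + q i Z (\<phi> - \<psi>) = 2 * q i Z \<phi> + 2 * q i Z \<psi>"
    if "i \<in> {1, 2}" "projection_op Z" for i Z \<phi> \<psi>
    unfolding q_def by (rule trace_projection_parallelogram[OF dim \<Phi>(1,2)[OF that(1)] that(2)])
  \<comment> \<open>The nondisturbance equation is tested on \<open>rank_one \<psi>\<close>; general
    coefficients \<open>a\<close> and \<open>b\<close> cover both effects of
    \<open>unsharp \<nu> B\<close>.\<close>
  have total: "a * (q 1 (B 1) \<psi> + q 2 (B 1) \<psi>) + b * (q 1 (B 2) \<psi> + q 2 (B 2) \<psi>)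
      = a * inner \<psi> (B 1 \<psi>) + b * inner \<psi> (B 2 \<psi>)"
    if ad: "adjoint_maps (total_map {1, 2} I) (\<lambda>x. a *\<^sub>R B 1 x + b *\<^sub>R B 2 x) (\<lambda>x. a *\<^sub>R B 1 x + b *\<^sub>R B 2 x)"
    for a b \<psi>
  proof -
    define X where "X = (\<lambda>x. a *\<^sub>R B 1 x + b *\<^sub>R B 2 x)"
    define T where "T i = I i (rank_one \<psi>)" for i
    have "trace (X \<circ> (\<lambda>x. T 1 x + T 2 x)) = cinner \<psi> (X \<psi>)"
    proof -
      have "total_map {1, 2} I (rank_one \<psi>) = (\<lambda>x. T 1 x + T 2 x)"
        by (simp add: total_map_def T_def)
      hence "trace (X \<circ> (\<lambda>x. T 1 x + T 2 x)) = trace (X \<circ> rank_one \<psi>)"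
        using ad tc unfolding adjoint_maps_def X_def by metis
      thus ?thesis
        using trace_compose_rank_one[OF dim, of X \<psi>] ad by (simp add: adjoint_maps_def X_def)
    qed
    hence "inner \<psi> (X \<psi>) = Re (trace (X \<circ> (\<lambda>x. T 1 x + T 2 x)))" by (simp add: inner_Re_cinner)
    moreover have "trace (X \<circ> (\<lambda>x. T 1 x + T 2 x))
      = of_real a * (trace (B 1 \<circ> T 1) + trace (B 1 \<circ> T 2)) + of_real b * (trace (B 2 \<circ> T 1) + trace (B 2 \<circ> T 2))"
    proof (rule trace_eqI)
      have "((\<lambda>e. cinner e (Z (T i e))) has_sum trace (Z \<circ> T i)) trace_basis"
        if "i \<in> {1, 2}" "projection_op Z" for i Z
        unfolding T_def
        by (rule trace_projection(1)[OF dim completely_positive_positive_op[OF \<Phi>(1,2)[OF that(1)] tc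
              positive_op_rank_one] that(2)])
      hence "((\<lambda>e. of_real a * (cinner e (B 1 (T 1 e)) + cinner e (B 1 (T 2 e)))
          + of_real b * (cinner e (B 2 (T 1 e)) + cinner e (B 2 (T 2 e)))) has_sum
        (of_real a * (trace (B 1 \<circ> T 1) + trace (B 1 \<circ> T 2))
          + of_real b * (trace (B 2 \<circ> T 1) + trace (B 2 \<circ> T 2)))) trace_basis"
        by (intro has_sum_add has_sum_cmult_right) (use P Q in simp_all)
      thus "((\<lambda>e. cinner e ((X \<circ> (\<lambda>x. T 1 x + T 2 x)) e)) has_sum
        (of_real a * (trace (B 1 \<circ> T 1) + trace (B 1 \<circ> T 2))
          + of_real b * (trace (B 2 \<circ> T 1) + trace (B 2 \<circ> T 2)))) trace_basis"
        by (simp add: X_def P.add Q.add cinner.add_right cinner.scaleR_right scaleR_conv_of_real)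
    qed
    ultimately show ?thesis
      by (simp add: X_def inner_add_right q_def T_def)
  qed
  have fixed: "q 1 (B 1) \<psi> + q 2 (B 1) \<psi> = inner \<psi> (B 1 \<psi>)"
    "q 1 (B 2) \<psi> + q 2 (B 2) \<psi> = inner \<psi> (B 2 \<psi>)" for \<psi>
  proof -
    define u v where "u = q 1 (B 1) \<psi> + q 2 (B 1) \<psi> - inner \<psi> (B 1 \<psi>)"
      and "v = q 1 (B 2) \<psi> + q 2 (B 2) \<psi> - inner \<psi> (B 2 \<psi>)"
    \<comment> \<open>The two outcomes give a linear system for the defects \<open>u\<close> and
      \<open>v\<close> with determinant \<open>2 * \<nu> - 1\<close>, which is nonzero.\<close>
    have "\<nu> * u + (1 - \<nu>) * v = 0" "(1 - \<nu>) * u + \<nu> * v = 0"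
      using total[of \<nu> "1 - \<nu>" \<psi>] total[of "1 - \<nu>" \<nu> \<psi>] nd[of 1] nd[of 2]
      by (simp_all add: unsharp_def u_def v_def algebra_simps)
    hence "u + v = 0" "(2 * \<nu> - 1) * (u - v) = 0" by (simp_all add: algebra_simps)
    hence "u = 0" "v = 0" using \<nu> by auto
    thus "q 1 (B 1) \<psi> + q 2 (B 1) \<psi> = inner \<psi> (B 1 \<psi>)"
      "q 1 (B 2) \<psi> + q 2 (B 2) \<psi> = inner \<psi> (B 2 \<psi>)"
      by (simp_all add: u_def v_def)
  qed
  \<comment> \<open>The adjoint equation at the identity is split along
    \<open>B 1 + B 2\<close>.\<close>
  have effect: "inner \<psi> (A 1 \<psi>) = q 1 (B 1) \<psi> + q 1 (B 2) \<psi>" for \<psi>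
  proof -
    have "((\<lambda>e. cinner e (B 1 (I 1 (rank_one \<psi>) e)) + cinner e (B 2 (I 1 (rank_one \<psi>) e))) has_sum
        (trace (B 1 \<circ> I 1 (rank_one \<psi>)) + trace (B 2 \<circ> I 1 (rank_one \<psi>)))) trace_basis"
      by (intro has_sum_add trace_projection(1) dim P Q
          completely_positive_positive_op[OF \<Phi>(1,2) tc positive_op_rank_one]) simp_all
    hence "trace (id \<circ> I 1 (rank_one \<psi>)) = trace (B 1 \<circ> I 1 (rank_one \<psi>)) + trace (B 2 \<circ> I 1 (rank_one \<psi>))"
      by (intro trace_eqI) (simp add: PQ flip: cinner.add_right)
    moreover have "trace (id \<circ> I 1 (rank_one \<psi>)) = trace (A 1 \<circ> rank_one \<psi>)"
      using \<Phi>(3)[of 1] tc unfolding adjoint_maps_def by blast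
    moreover have "trace (A 1 \<circ> rank_one \<psi>) = cinner \<psi> (A 1 \<psi>)"
      using \<Phi>(3)[of 1] by (intro trace_compose_rank_one dim) (simp add: adjoint_maps_def)
    ultimately have "cinner \<psi> (A 1 \<psi>)
        = trace (B 1 \<circ> I 1 (rank_one \<psi>)) + trace (B 2 \<circ> I 1 (rank_one \<psi>))" by metis
    thus ?thesis by (simp add: q_def inner_Re_cinner)
  qed
  show ?thesis
  proof (rule complementary_projections_commute[OF P Q PQ A])
    fix \<phi> \<psi> :: 'a
    assume "B 1 \<phi> = 0" "B 2 \<psi> = 0"
    \<comment> \<open>By \<open>fixed\<close>, two nonnegative numbers add up to zero, so each of
      them vanishes.\<close>
    hence "q 1 (B 1) \<phi> = 0" "q 1 (B 2) \<psi> = 0"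
      using fixed[of \<phi>] fixed[of \<psi>] q[of 1 "B 1" \<phi>] q[of 2 "B 1" \<phi>]
        q[of 1 "B 2" \<psi>] q[of 2 "B 2" \<psi>] P Q by simp_all
    \<comment> \<open>Adding a null vector leaves the form unchanged. The form of \<open>A 1\<close>
      is therefore additive at \<open>\<psi> + \<phi>\<close>, which kills its cross term.\<close>
    hence "q 1 (B 1) (\<psi> + \<phi>) = q 1 (B 1) \<psi>" "q 1 (B 2) (\<phi> + \<psi>) = q 1 (B 2) \<phi>"
      using P Q by (intro parallelogram_null_vector q q_par; simp)+
    hence "inner (\<psi> + \<phi>) (A 1 (\<psi> + \<phi>)) = inner \<psi> (A 1 \<psi>) + inner \<phi> (A 1 \<phi>)"
      unfolding effect using \<open>q 1 (B 1) \<phi> = 0\<close> \<open>q 1 (B 2) \<psi> = 0\<close> by (simp add: add.commute)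
    moreover have "A 1 (\<psi> + \<phi>) = A 1 \<psi> + A 1 \<phi>"
      using pos_symD(1)[OF A] by (simp add: linear_add bounded_linear.linear)
    moreover have "inner \<psi> (A 1 \<phi>) = inner \<phi> (A 1 \<psi>)"
      using pos_symD(2)[OF A, of \<psi> \<phi>] by (simp add: inner_commute)
    ultimately show "inner \<phi> (A 1 \<psi>) = 0" by (simp add: inner_add_left inner_add_right)
  qed
qed

text \<open>The effect \<open>unsharp \<mu> A 1\<close> is affine in \<open>A 1\<close> with nonzero
  slope \<open>2 * \<mu> - 1\<close>, so what commutes with it commutes with \<open>A 1\<close>. The
  other pairs follow by taking complements.\<close>

lemma nondisturbing_sharp_commuting:
  fixes A B :: "nat \<Rightarrow> 'a::chilbert_space \<Rightarrow> 'a"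
  assumes dim: "countable_dimension TYPE('a)"
    and A: "observable {1, 2} A" "sharp {1, 2} A" and B: "observable {1, 2} B" "sharp {1, 2} B"
    and \<mu>: "1/2 < \<mu>" "\<mu> \<le> 1" and \<nu>: "1/2 < \<nu>"
    and nd: "measurable_without_disturbing {1, 2} (unsharp \<mu> A) {1, 2} (unsharp \<nu> B)"
  shows "commuting {1, 2} A {1, 2} B"
proof -
  obtain I where I: "implementing_instrument {1, 2} (unsharp \<mu> A) I"
    "\<And>y. y \<in> {1, 2} \<Longrightarrow> adjoint_maps (total_map {1, 2} I) (unsharp \<nu> B y) (unsharp \<nu> B y)"
    using nd unfolding measurable_without_disturbing_def by blast
  have "pos_sym (unsharp \<mu> A 1)"
    using \<mu> projection_op_pos_sym[OF sharp_binaryD(1)[OF A]] projection_op_pos_sym[OF sharp_binaryD(2)[OF A]]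
    by (intro pos_sym_unsharp) simp_all
  hence comm: "B 1 (unsharp \<mu> A 1 x) = unsharp \<mu> A 1 (B 1 x)" for x
    using \<nu> by (intro nondisturbing_effect_commutes[OF dim B _ I(1) _ I(2)]) simp_all
  have A2: "A 2 x = x - A 1 x" and B2: "B 2 x = x - B 1 x" for x
    using sharp_binaryD(3)[OF A, of x] sharp_binaryD(3)[OF B, of x] by (simp_all add: algebra_simps)
  interpret A1: bounded_linear "A 1"
    using projection_opD(1)[OF sharp_binaryD(1)[OF A]] by (rule bounded_clinearD)
  interpret B1: bounded_linear "B 1"
    using projection_opD(1)[OF sharp_binaryD(1)[OF B]] by (rule bounded_clinearD)
  have eff: "unsharp \<mu> A 1 x = (2 * \<mu> - 1) *\<^sub>R A 1 x + (1 - \<mu>) *\<^sub>R x" for x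
    by (simp add: unsharp_def A2 algebra_simps) (simp flip: scaleR_add_left)
  have "A 1 (B 1 x) = B 1 (A 1 x)" for x
  proof -
    have "(2 * \<mu> - 1) *\<^sub>R B 1 (A 1 x) = (2 * \<mu> - 1) *\<^sub>R A 1 (B 1 x)"
      using comm[of x] by (simp add: eff B1.add B1.scaleR)
    thus ?thesis using \<mu> by simp
  qed
  thus ?thesis
    by (simp add: commuting_def fun_eq_iff A2 B2 A1.diff B1.diff algebra_simps)
qed

lemma commuting_sym: "commuting X A Y B \<Longrightarrow> commuting Y B X A"
  by (auto simp: commuting_def)


section \<open>Joint measurability\<close>

text \<open>Toss a fair coin to decide which of the two observables to measure and guess the outcome of
  the other one; this realizes every \<open>\<mu> \<le> 3/4\<close>.\<close>

lemma jointly_measurable_unsharp: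
  fixes A B :: "nat \<Rightarrow> 'a::chilbert_space \<Rightarrow> 'a"
  assumes A: "observable {1, 2} A" and B: "observable {1, 2} B" and \<mu>: "1/2 \<le> \<mu>" "\<mu> \<le> 3/4"
  shows "jointly_measurable {1, 2} (unsharp \<mu> A) {1, 2} (unsharp \<mu> B)"
proof -
  define t where "t = 2 * \<mu> - 1"
  \<comment> \<open>A mixture: weight \<open>2 * t\<close> on the coin toss observable and
    \<open>1 - 2 * t\<close> on a uniformly random pair of outcomes. The second weight is
    nonnegative exactly when \<open>\<mu> \<le> 3/4\<close>.\<close>
  define G where "G = (\<lambda>(x, y) \<psi>. (t / 2) *\<^sub>R A x \<psi> + (t / 2) *\<^sub>R B y \<psi> + ((1 - 2 * t) / 4) *\<^sub>R \<psi>)"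
  have "positive_op (G (x, y))" if "x \<in> {1, 2}" "y \<in> {1, 2}" for x y
  proof -
    have "positive_op (A x)" "positive_op (B y)" using A B that by (auto simp: observable_def)
    thus ?thesis
      unfolding G_def prod.case using \<mu>
      by (intro positive_op_add positive_op_scaleR positive_op_id) (simp_all add: t_def)
  qed
  hence pos: "positive_op (G p)" if "p \<in> {1, 2} \<times> {1, 2}" for p using that by blast
  have unsharp: "unsharp \<mu> C x \<psi> = t *\<^sub>R C x \<psi> + ((1 - t) / 2) *\<^sub>R \<psi>"
    if "observable {1, 2} C" "x \<in> {1, 2}" for C :: "nat \<Rightarrow> 'a \<Rightarrow> 'a" and x \<psi>
  proof -
    have "unsharp \<mu> C x \<psi> = (2 * \<mu> - 1) *\<^sub>R C x \<psi> + (1 - \<mu>) *\<^sub>R (C 1 \<psi> + C 2 \<psi>)"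
      using that(2) by (auto simp: unsharp_def scaleR_add_right add.assoc simp flip: scaleR_add_left)
    moreover have "1 - \<mu> = (1 - t) / 2" by (simp add: t_def field_simps)
    ultimately show ?thesis by (simp add: binary_observable_sum[OF that(1)] t_def)
  qed
  \<comment> \<open>Both marginals at once: \<open>a\<close> belongs to the outcome that is kept,
    \<open>b\<close> and \<open>c\<close> to the two outcomes summed over.\<close>
  have half: "((t / 2) *\<^sub>R a + (t / 2) *\<^sub>R b + ((1 - 2 * t) / 4) *\<^sub>R \<psi>)
      + ((t / 2) *\<^sub>R a + (t / 2) *\<^sub>R c + ((1 - 2 * t) / 4) *\<^sub>R \<psi>) = t *\<^sub>R a + ((1 - t) / 2) *\<^sub>R \<psi>"
    if "b + c = \<psi>" for a b c \<psi> :: 'a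
  proof -
    have "((t / 2) *\<^sub>R a + (t / 2) *\<^sub>R b + ((1 - 2 * t) / 4) *\<^sub>R \<psi>)
        + ((t / 2) *\<^sub>R a + (t / 2) *\<^sub>R c + ((1 - 2 * t) / 4) *\<^sub>R \<psi>)
      = (t / 2 + t / 2) *\<^sub>R a + ((t / 2) *\<^sub>R (b + c) + ((1 - 2 * t) / 4 + (1 - 2 * t) / 4) *\<^sub>R \<psi>)"
      by (simp only: scaleR_add_left scaleR_add_right ac_simps)
    also have "\<dots> = (t / 2 + t / 2) *\<^sub>R a + (t / 2 + ((1 - 2 * t) / 4 + (1 - 2 * t) / 4)) *\<^sub>R \<psi>"
      by (simp only: that scaleR_add_left)
    also have "t / 2 + ((1 - 2 * t) / 4 + (1 - 2 * t) / 4) = (1 - t) / 2" by (simp add: field_simps)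
    finally show ?thesis by simp
  qed
  have margA: "(\<Sum>y\<in>{1, 2}. G (x, y) \<psi>) = unsharp \<mu> A x \<psi>" if "x \<in> {1, 2}" for x \<psi>
    unfolding unsharp[OF A that] half[OF binary_observable_sum[OF B], symmetric] by (simp add: G_def)
  have margB: "(\<Sum>x\<in>{1, 2}. G (x, y) \<psi>) = unsharp \<mu> B y \<psi>" if "y \<in> {1, 2}" for y \<psi>
    unfolding unsharp[OF B that] half[OF binary_observable_sum[OF A], symmetric] by (simp add: G_def add.commute)
  have "(\<Sum>p\<in>{1, 2} \<times> {1, 2}. G p \<psi>) = \<psi>" for \<psi>
  proof -
    have "(\<Sum>p\<in>{1, 2} \<times> {1, 2}. G p \<psi>) = (\<Sum>x\<in>{1, 2}. \<Sum>y\<in>{1, 2}. G (x, y) \<psi>)"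
      by (simp only: sum.cartesian_product split_def prod.collapse)
    also have "\<dots> = (\<Sum>x\<in>{1, 2}. unsharp \<mu> A x \<psi>)"
      by (intro sum.cong refl margA)
    also have "\<dots> = A 1 \<psi> + A 2 \<psi>"
      by (simp add: unsharp_def algebra_simps)
    also have "\<dots> = \<psi>" by (rule binary_observable_sum[OF A])
    finally show ?thesis .
  qed
  hence "((\<lambda>p. G p \<psi>) has_sum \<psi>) ({1, 2} \<times> {1, 2})" for \<psi>
    by (intro has_sum_finiteI) simp_all
  moreover have "((\<lambda>y. G (x, y) \<psi>) has_sum unsharp \<mu> A x \<psi>) {1, 2}" if "x \<in> {1, 2}" for x \<psi>
    using margA[OF that] by (intro has_sum_finiteI) simp_all
  moreover have "((\<lambda>x. G (x, y) \<psi>) has_sum unsharp \<mu> B y \<psi>) {1, 2}" if "y \<in> {1, 2}" for y \<psi>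
    using margB[OF that] by (intro has_sum_finiteI) simp_all
  moreover have "countable ({1, 2} \<times> {1, 2} :: (nat \<times> nat) set)"
    by (intro countable_finite) simp
  ultimately show ?thesis
    unfolding jointly_measurable_def observable_def using pos
    by (intro exI[of _ G] conjI ballI allI)
qed

theorem mainTheorem4:
  fixes A B :: "nat \<Rightarrow> 'h::chilbert_space \<Rightarrow> 'h"
  assumes "countable_dimension TYPE('h)"
    and "observable {1, 2} A" and "observable {1, 2} B"
    and "sharp {1, 2} A" and "sharp {1, 2} B"
    and "\<not> commuting {1, 2} A {1, 2} B"
  shows "(\<forall>\<mu>. 1/2 < \<mu> \<and> \<mu> \<le> 2/3 \<longrightarrow>
            jointly_measurable {1, 2} (unsharp \<mu> A) {1, 2} (unsharp \<mu> B)) \<and>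
         (\<forall>\<mu> \<nu>. 1/2 < \<mu> \<and> \<mu> \<le> 1 \<and> 1/2 < \<nu> \<and> \<nu> \<le> 1 \<longrightarrow>
            \<not> measurable_without_disturbing {1, 2} (unsharp \<mu> A) {1, 2} (unsharp \<nu> B) \<and>
            \<not> measurable_without_disturbing {1, 2} (unsharp \<nu> B) {1, 2} (unsharp \<mu> A))"
proof (intro conjI allI impI)
  fix \<mu> :: real
  assume "1/2 < \<mu> \<and> \<mu> \<le> 2/3"
  thus "jointly_measurable {1, 2} (unsharp \<mu> A) {1, 2} (unsharp \<mu> B)"
    by (intro jointly_measurable_unsharp assms) simp_all
next
  fix \<mu> \<nu> :: real
  assume *: "1/2 < \<mu> \<and> \<mu> \<le> 1 \<and> 1/2 < \<nu> \<and> \<nu> \<le> 1"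
  show "\<not> measurable_without_disturbing {1, 2} (unsharp \<mu> A) {1, 2} (unsharp \<nu> B)"
  proof
    assume "measurable_without_disturbing {1, 2} (unsharp \<mu> A) {1, 2} (unsharp \<nu> B)"
    hence "commuting {1, 2} A {1, 2} B"
      using * by (intro nondisturbing_sharp_commuting[OF assms(1,2,4,3,5)]) simp_all
    with assms(6) show False ..
  qed
  show "\<not> measurable_without_disturbing {1, 2} (unsharp \<nu> B) {1, 2} (unsharp \<mu> A)"
  proof
    assume "measurable_without_disturbing {1, 2} (unsharp \<nu> B) {1, 2} (unsharp \<mu> A)"
    hence "commuting {1, 2} B {1, 2} A"
      using * by (intro nondisturbing_sharp_commuting[OF assms(1,3,5,2,4)]) simp_all
    with assms(6) show False by (simp add: commuting_sym)
  qed
qed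

end
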